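(* Assume Conditions 1, 2 and 3 (stated in the context) hold and that $k'(-1)>0$. Then there exists a positive function $u:\mathbb{X}^2\to(0,+\infty)$ such that for any $(i,j)\in\mathbb{X}^2$ and any $z\in\mathbb{N}$, as $n\to+\infty$, $$\mathbb{P}_i(Z_n=z,\,X_n=j)\sim \big(k(-1)\big)^n\,u(i,j).$$
   Context: Notation: $\mathbb{N}=\{1,2,\ldots\}$, $\mathbb{N}_0=\mathbb{N}\cup\{0\}$. Environment: $X=(X_n)_{n\ge0}$ is a time-homogeneous Markov chain with finite state space $\mathbb{X}$ and transition matrix $\mathbf{P}=(\mathbf{P}(i,j))_{i,j\in\mathbb{X}}$. $\mathbb{P}_i$, $\mathbb{E}_i$ denote probability and expectation when $X_0=i$, and $\mathbf{P}g(i)=\mathbb{E}_i[g(X_1)]$ for $g$ on $\mathbb{X}$. Linear fractional offspring: for each $i\in\mathbb{X}$ let $a_i\in[0,1)$, $p_i\in(0,1)$. The offspring law in state $i$ is the probability on $\mathbb{N}_0$ giving mass $a_i$ to $0$ and mass $(1-a_i)(1-p_i)p_i^{k-1}$ to each $k\in\mathbb{N}$; its generating function is $f_i(s)=1-\frac{(1-a_i)(1-s)}{1-p_is}$, $s\in[0,1]$, with mean $m_i=f_i'(1)=\frac{1-a_i}{1-p_i}$. Branching process: $Z_0=1$ and $Z_n=\sum_{l=1}^{Z_{n-1}}\xi^{n,l}_{X_n}$ for $n\in\mathbb{N}$, where the random variables $\xi^{n,l}_i$ ($i\in\mathbb{X}$, $n,l\ge1$) are independent, independent of the chain $X$, and $\xi_i^{n,l}$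 has the offspring law of state $i$. Markov walk: $\rho(i)=\ln f_i'(1)=\ln m_i$, $S_0=0$, $S_n=\sum_{k=1}^n\rho(X_k)$. For $\lambda\in\mathbb{R}$, $k(\lambda)=\lim_{n\to+\infty}\big(\mathbb{E}_i[e^{\lambda S_n}]\big)^{1/n}$; under Conditions 1 and 2 this limit exists, is positive, does not depend on $i$, and $k$ is differentiable. Condition 1 (irreducible and aperiodic environment): there is $k_0\in\mathbb{N}$ such that for every non-negative, not identically zero function $g$ on $\mathbb{X}$ and every $i\in\mathbb{X}$, $\mathbf{P}^{k_0}g(i)>0$. Condition 2 (non-lattice environment): for any $(\theta,b)\in\mathbb{R}^2$ there exists a path $x_0,\ldots,x_n$ in $\mathbb{X}$ with $\mathbf{P}(x_0,x_1)\cdots\mathbf{P}(x_{n-1},x_n)\mathbf{P}(x_n,x_0)>0$ and $\rho(x_0)+\cdots+\rho(x_n)-(n+1)\theta\notin b\mathbb{Z}$. Condition 3 (supercritical branching): $0<a_i<p_i<1$ for every $i\in\mathbb{X}$. *)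

theory Defs
  imports "HOL-Probability.Probability" "HOL-Library.Landau_Symbols"
begin

section \<open>Linear fractional offspring laws\<close>

definition lf_mass :: "real \<Rightarrow> real \<Rightarrow> nat \<Rightarrow> real" where
  "lf_mass a p k = (if k = 0 then a else (1 - a) * (1 - p) * p ^ (k - 1))"

definition lf_gf :: "real \<Rightarrow> real \<Rightarrow> real \<Rightarrow> real" where
  "lf_gf a p s = 1 - (1 - a) * (1 - s) / (1 - p * s)"

definition lf_mean :: "real \<Rightarrow> real \<Rightarrow> real" where
  "lf_mean a p = deriv (lf_gf a p) 1"

lemma lf_mass_sums_lf_gf:
  assumes "0 < p" "p < 1" "0 \<le> s" "s \<le> 1"
  shows "(\<lambda>k. lf_mass a p k * s ^ k) sums lf_gf a p s"
proof -
  have ps: "\<bar>p * s\<bar> < 1"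
    using assms by (smt (verit) mult_left_le mult_nonneg_nonneg)
  have "(\<lambda>k. (1 - a) * (1 - p) * s * (p * s) ^ k) sums ((1 - a) * (1 - p) * s * (1 / (1 - p * s)))"
    by (intro sums_mult geometric_sums) (use ps in simp)
  moreover have "(\<lambda>k. lf_mass a p (Suc k) * s ^ Suc k) = (\<lambda>k. (1 - a) * (1 - p) * s * (p * s) ^ k)"
    by (auto simp: lf_mass_def power_mult_distrib)
  ultimately have "(\<lambda>k. lf_mass a p k * s ^ k) sums
      ((1 - a) * (1 - p) * s * (1 / (1 - p * s)) + lf_mass a p 0 * s ^ 0)"
    by (subst sums_Suc_iff [symmetric]) simp
  moreover have "(1 - a) * (1 - p) * s * (1 / (1 - p * s)) + lf_mass a p 0 * s ^ 0 = lf_gf a p s"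
    using ps by (simp add: lf_mass_def lf_gf_def field_simps)
  ultimately show ?thesis by simp
qed

lemma lf_mean_eq:
  assumes "p < 1"
  shows "lf_mean a p = (1 - a) / (1 - p)"
proof -
  have "(lf_gf a p has_real_derivative (1 - a) / (1 - p)) (at 1)"
    unfolding lf_gf_def [abs_def] using assms
    by (auto intro!: derivative_eq_intros simp: minus_divide_left)
  then show ?thesis
    unfolding lf_mean_def by (rule DERIV_imp_deriv)
qed


section \<open>Branching process in a Markovian environment\<close>

text \<open>
  The measure \<open>M i\<close> plays the role of $\mathbb{P}_i$. As usual for Markov chains, the random variables
  \<open>X n\<close> and \<open>\<xi> x n l\<close> are the same functions on the sample space for all starting points; only the
  measure varies. The variables \<open>\<xi> x n l\<close> are only constrained for \<open>n, l \<ge> 1\<close>.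
\<close>

locale lf_branching_markov_env =
  fixes P :: "'x::finite \<Rightarrow> 'x \<Rightarrow> real"
    and a p :: "'x \<Rightarrow> real"
    and M :: "'x \<Rightarrow> 'w measure"
    and X :: "nat \<Rightarrow> 'w \<Rightarrow> 'x"
    and \<xi> :: "'x \<Rightarrow> nat \<Rightarrow> nat \<Rightarrow> 'w \<Rightarrow> nat"
  assumes P_nonneg: "\<And>x y. 0 \<le> P x y"
    and P_row_sum: "\<And>x. (\<Sum>y\<in>UNIV. P x y) = 1"
    and a_range: "\<And>x. 0 \<le> a x" "\<And>x. a x < 1"
    and p_range: "\<And>x. 0 < p x" "\<And>x. p x < 1"
    and prob_space_M: "\<And>i. prob_space (M i)"
    and X_measurable: "\<And>i n. X n \<in> measurable (M i) (count_space UNIV)"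
    and X_start: "\<And>i. AE \<omega> in M i. X 0 \<omega> = i"
    and X_markov:
      "\<And>i n (path :: nat \<Rightarrow> 'x) x. \<P>(\<omega> in M i. \<forall>k\<le>n. X k \<omega> = path k) > 0 \<Longrightarrow>
       \<P>(\<omega> in M i. X (Suc n) \<omega> = x \<bar> \<forall>k\<le>n. X k \<omega> = path k) = P (path n) x"
    and \<xi>_indep:
      "\<And>i. prob_space.indep_vars (M i) (\<lambda>_. count_space UNIV) (\<lambda>(x, n, l). \<xi> x n l)
         {(x, n, l). 1 \<le> n \<and> 1 \<le> l}"
    and \<xi>_law:
      "\<And>i x n l k. 1 \<le> n \<Longrightarrow> 1 \<le> l \<Longrightarrow> \<P>(\<omega> in M i. \<xi> x n l \<omega> = k) = lf_mass (a x) (p x) k"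
    and X_\<xi>_indep:
      "\<And>i. prob_space.indep_set (M i)
         (sigma_sets (space (M i)) {X n -` B \<inter> space (M i) | n B. True})
         (sigma_sets (space (M i)) {\<xi> x n l -` B \<inter> space (M i) | x n l B. 1 \<le> n \<and> 1 \<le> l})"

primrec branching ::
  "(nat \<Rightarrow> 'w \<Rightarrow> 'x) \<Rightarrow> ('x \<Rightarrow> nat \<Rightarrow> nat \<Rightarrow> 'w \<Rightarrow> nat) \<Rightarrow> nat \<Rightarrow> 'w \<Rightarrow> nat" where
  "branching X \<xi> 0 \<omega> = 1"
| "branching X \<xi> (Suc n) \<omega> = (\<Sum>l = 1..branching X \<xi> n \<omega>. \<xi> (X (Suc n) \<omega>) (Suc n) l \<omega>)"


section \<open>The associated Markov walk\<close>

definition log_mean :: "('x \<Rightarrow> real) \<Rightarrow> ('x \<Rightarrow> real) \<Rightarrow> 'x \<Rightarrow> real" where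
  "log_mean a p x = ln (lf_mean (a x) (p x))"

definition markov_walk :: "('x \<Rightarrow> real) \<Rightarrow> (nat \<Rightarrow> 'w \<Rightarrow> 'x) \<Rightarrow> nat \<Rightarrow> 'w \<Rightarrow> real" where
  "markov_walk \<rho> X n \<omega> = (\<Sum>k = 1..n. \<rho> (X k \<omega>))"

text \<open>
  The common value over all starting points \<open>i\<close> of the limit of
  $(\mathbb{E}_i [e^{t S_n}])^{1/n}$.
\<close>

definition walk_growth ::
  "('x \<Rightarrow> real) \<Rightarrow> ('x \<Rightarrow> 'w measure) \<Rightarrow> (nat \<Rightarrow> 'w \<Rightarrow> 'x) \<Rightarrow> real \<Rightarrow> real" where
  "walk_growth \<rho> M X t =
     (THE L. \<forall>i. (\<lambda>n. (\<integral>\<omega>. exp (t * markov_walk \<rho> X n \<omega>) \<partial>M i) powr (1 / real n)) \<longlonglongrightarrow> L)"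


section \<open>Conditions\<close>

definition trans_op :: "('x::finite \<Rightarrow> 'x \<Rightarrow> real) \<Rightarrow> ('x \<Rightarrow> real) \<Rightarrow> 'x \<Rightarrow> real" where
  "trans_op P g x = (\<Sum>y\<in>UNIV. P x y * g y)"

definition primitive_env :: "('x::finite \<Rightarrow> 'x \<Rightarrow> real) \<Rightarrow> bool" where
  "primitive_env P \<longleftrightarrow>
     (\<exists>k\<ge>1. \<forall>g. (\<forall>x. 0 \<le> g x) \<and> (\<exists>x. g x \<noteq> 0) \<longrightarrow> (\<forall>i. 0 < (trans_op P ^^ k) g i))"

definition non_lattice_env :: "('x \<Rightarrow> 'x \<Rightarrow> real) \<Rightarrow> ('x \<Rightarrow> real) \<Rightarrow> bool" where
  "non_lattice_env P \<rho> \<longleftrightarrow>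
     (\<forall>\<theta> b :: real. \<exists>n. \<exists>x :: nat \<Rightarrow> 'x.
        (\<Prod>k<n. P (x k) (x (Suc k))) * P (x n) (x 0) > 0 \<and>
        (\<Sum>k\<le>n. \<rho> (x k)) - real (n + 1) * \<theta> \<notin> range (\<lambda>m :: int. b * of_int m))"

definition supercritical :: "('x \<Rightarrow> real) \<Rightarrow> ('x \<Rightarrow> real) \<Rightarrow> bool" where
  "supercritical a p \<longleftrightarrow> (\<forall>x. 0 < a x \<and> a x < p x \<and> p x < 1)"

end

theory Submission imports Defs begin

text \<open>
  In a fixed environment \<open>x\<close> the generating function $F$ of $Z_n$ satisfies
  $1 - F(s) = (1-s)/(A_n + B_n(1-s))$ with $A_n = e^{-S_n}$ and
  $B_n = \sum_{k<n} e^{-S_k} \eta(x_{k+1})$, $\eta = p/(1-a)$. Hence for $z \ge 1$ the probability of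
  $Z_n = z$ and $X_n = j$ is the expectation of $A_n\, B_n^{z-1}/(A_n+B_n)^{z+1}$ on $X_n = j$.

  The factor $A_n = e^{-S_n}$ tilts the chain by the Perron eigenvector of
  $P(x,y) e^{-\rho(y)}$, with Perron root $k(-1)$. Since $k$ is differentiable, $k'(-1) > 0$ gives
  $\delta \in (0,1]$ with $k(-1-\delta) < k(-1)$, so that under the tilted law
  $A_l^\delta$ has exponentially small expectation. Therefore $B_n^{z-1}/(A_n+B_n)^{z+1}$ may be
  replaced by $B_m^{-2}$ up to an exponentially small error in $m$, uniformly in $n \ge m$, and
  letting first $n$ and then $m$ tend to infinity the convergence of powers of a primitive matrix gives
  the limit, which does not involve $z$. Differentiability of $k$ follows from a Doeblin contraction
  estimate, which makes the Perron eigenvector continuous in the parameter.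
\<close>

section \<open>Primitive non-negative matrices\<close>

text \<open>Under the tilted law the walk has drift k'(-1) / k(-1) > 0, so A_n tends to 0, B_n has a
  finite limit, and the weight tends to the inverse square of that limit for every z. Hence u(i,j)
  is the right eigenvector at i times the left one at j times a tilted expectation. Neither the
  tilted law nor the infinite series is constructed: everything is an expectation of a functional of
  finitely many states, normalised by a power of the Perron root.

  The obstacle is integrability, since the tilted mean of B_n may be unbounded in n. But B_n is
  bounded below by \<open>\<eta>_min\<close> for n \<ge> 1, so all errors are bounded, and a bounded
  error is controlled through min(1, t) \<le> t^\<delta> by a fractional moment. The same truncation
  keeps the limit away from 0.

  Differentiability has to be proved because \<open>deriv\<close> is a choice operator: a positive
  value means nothing until a derivative exists. The eigenvectors are chosen separately for every
  parameter, with no regularity to start from, and this determines how the perturbation argument is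
  set up.\<close>

lemma trans_op_mono:
  assumes "\<And>x y. 0 \<le> Q x y" "\<And>x. g x \<le> h x"
  shows "trans_op Q g x \<le> trans_op Q h x"
  unfolding trans_op_def by (intro sum_mono mult_left_mono assms)

lemma trans_op_pow_mono:
  assumes "\<And>x y. 0 \<le> Q x y" "\<And>x. g x \<le> h x"
  shows "(trans_op Q ^^ n) g x \<le> (trans_op Q ^^ n) h x"
  using assms(2) by (induction n arbitrary: x) (auto intro: trans_op_mono assms(1))

lemma trans_op_scale: "trans_op Q (\<lambda>x. c * g x) = (\<lambda>x. c * trans_op Q g x)"
  by (simp add: trans_op_def sum_distrib_left mult.left_commute fun_eq_iff)

lemma trans_op_pow_scale: "(trans_op Q ^^ n) (\<lambda>x. c * g x) = (\<lambda>x. c * (trans_op Q ^^ n) g x)"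
  by (induction n) (simp_all add: trans_op_scale)

lemma trans_op_pow_eigenvector:
  assumes "\<And>x. trans_op Q v x = \<kappa> * v x"
  shows "(trans_op Q ^^ n) v = (\<lambda>x. \<kappa> ^ n * v x)"
  by (induction n) (auto simp: trans_op_scale assms)

text \<open>Matrix powers occur only as operators on functions;
  \<open>(trans_op Q ^^ n) (indicat_real {j}) x\<close> is the (x, j) entry of the n-th power, and
  linearity recovers the operator from its entries.\<close>

lemma trans_op_pow_expand:
  "(trans_op Q ^^ n) g x = (\<Sum>j\<in>UNIV. (trans_op Q ^^ n) (indicat_real {j}) x * g j)"
proof (induction n arbitrary: x)
  case 0
  show ?case by (simp add: indicator_def)
next
  case (Suc n)
  have "(trans_op Q ^^ Suc n) g x = trans_op Q (\<lambda>x. (trans_op Q ^^ n) g x) x"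
    by simp
  also have "\<dots> = trans_op Q (\<lambda>x. \<Sum>j\<in>UNIV. (trans_op Q ^^ n) (indicat_real {j}) x * g j) x"
    by (subst Suc.IH) simp
  also have "\<dots> = (\<Sum>j\<in>UNIV. (trans_op Q ^^ Suc n) (indicat_real {j}) x * g j)"
    unfolding trans_op_def funpow.simps comp_def sum_distrib_left sum_distrib_right
    by (subst sum.swap) (simp add: mult_ac)
  finally show ?case .
qed

text \<open>Finiteness of the state space turns strict positivity of the entries into a single
  Doeblin constant, on which all contraction estimates rest.\<close>

lemma primitive_entries_bounded_below:
  fixes Q :: "'x::finite \<Rightarrow> 'x \<Rightarrow> real"
  assumes "primitive_env Q"
  obtains k \<epsilon> where "\<epsilon> > 0" "\<And>i j. \<epsilon> \<le> (trans_op Q ^^ k) (indicat_real {j}) i"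
proof -
  from assms obtain k
    where pos: "\<And>g i. (\<forall>x. 0 \<le> g x) \<Longrightarrow> (\<exists>x. g x \<noteq> 0) \<Longrightarrow> 0 < (trans_op Q ^^ k) g i"
    unfolding primitive_env_def by metis
  define \<epsilon> where "\<epsilon> = Min (range (\<lambda>(i, j). (trans_op Q ^^ k) (indicat_real {j}) i))"
  have "(trans_op Q ^^ k) (indicat_real {j}) i > 0" for i j
    by (rule pos) (auto simp: indicator_def)
  then have "\<epsilon> > 0" unfolding \<epsilon>_def by (subst Min_gr_iff) auto
  moreover have "\<epsilon> \<le> (trans_op Q ^^ k) (indicat_real {j}) i" for i j
    unfolding \<epsilon>_def by (rule Min_le) auto
  ultimately show ?thesis using that by blast
qed

text \<open>Only the zero pattern of a matrix matters for primitivity: if \<open>c0\<close> is the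
  smallest factor, the n-th power of the new matrix dominates \<open>c0 ^ n\<close> times that of
  the old one. This covers the exponential tilts of \<open>P\<close> and their stochastic
  normalisations.\<close>

lemma primitive_env_scale_entries:
  fixes Q :: "'x::finite \<Rightarrow> 'x \<Rightarrow> real"
  assumes nonneg: "\<And>x y. 0 \<le> Q x y" and prim: "primitive_env Q" and c: "\<And>x y. 0 < c x y"
  shows "primitive_env (\<lambda>x y. Q x y * c x y)"
proof -
  define Q' where "Q' = (\<lambda>x y. Q x y * c x y)"
  define c0 where "c0 = Min (range (\<lambda>(x, y). c x y))"
  have c0: "c0 > 0" unfolding c0_def by (subst Min_gr_iff) (auto simp: c)
  have c0_le: "c0 \<le> c x y" for x y unfolding c0_def by (rule Min_le) auto
  have Q': "0 \<le> Q' x y" "c0 * Q x y \<le> Q' x y" for x y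
    using c[of x y] nonneg[of x y] c0_le[of x y]
    by (auto simp: Q'_def less_imp_le mult.commute[of c0] intro!: mult_left_mono)
  have step: "c0 * trans_op Q g x \<le> trans_op Q' g x" if "\<And>x. 0 \<le> g x" for g x
    unfolding trans_op_def sum_distrib_left mult.assoc[symmetric]
    by (intro sum_mono mult_right_mono Q' that)
  \<comment> \<open>One induction for both claims, because the step of the first applies
    \<open>step\<close> to an iterate that must already be known to be non-negative.\<close>
  have ge: "c0 ^ n * (trans_op Q ^^ n) g x \<le> (trans_op Q' ^^ n) g x"
    and nn: "0 \<le> (trans_op Q' ^^ n) g x" if g: "\<And>x. 0 \<le> g x" for n g x
  proof (induction n arbitrary: x)
    case 0 { case 1 show ?case by simp next case 2 show ?case using g by simp }
  next
    case (Suc n)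
    {
      case 1
      have "c0 ^ Suc n * (trans_op Q ^^ Suc n) g x
          = c0 * trans_op Q (\<lambda>x. c0 ^ n * (trans_op Q ^^ n) g x) x"
        by (simp add: trans_op_scale)
      also have "\<dots> \<le> c0 * trans_op Q (\<lambda>x. (trans_op Q' ^^ n) g x) x"
        using c0 Suc.IH(1) nonneg by (intro mult_left_mono trans_op_mono) auto
      also have "\<dots> \<le> (trans_op Q' ^^ Suc n) g x"
        using step[of "(trans_op Q' ^^ n) g" x] Suc.IH(2) by simp
      finally show ?case .
    next
      case 2
      show ?case using Q'(1) Suc.IH(2)
        by (auto simp: trans_op_def intro!: sum_nonneg mult_nonneg_nonneg)
    }
  qed
  from prim obtain k where k: "k \<ge> 1"
    and pos: "\<And>g i. (\<forall>x. 0 \<le> g x) \<Longrightarrow> (\<exists>x. g x \<noteq> 0) \<Longrightarrow> 0 < (trans_op Q ^^ k) g i"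
    unfolding primitive_env_def by metis
  have "0 < (trans_op Q' ^^ k) g i" if "\<forall>x. 0 \<le> g x" "\<exists>x. g x \<noteq> 0" for g i
    using ge[of g k i] pos[OF that, of i] that(1) c0
    by (meson less_le_trans mult_pos_pos zero_less_power)
  then show ?thesis using k unfolding primitive_env_def Q'_def[symmetric] by blast
qed

section \<open>Existence of a positive eigenvector\<close>

text \<open>Brouwer's theorem applies to the normalised map Qx / |Qx| on the simplex. Primitivity
  enters twice: Qx never vanishes there, so the normalisation is continuous, and the fixed point is
  strictly positive because its k-th image is.\<close>

lemma primitive_perron_eigenvector:
  fixes Q :: "'x::finite \<Rightarrow> 'x \<Rightarrow> real"
  assumes nonneg: "\<And>x y. 0 \<le> Q x y" and prim: "primitive_env Q"
  obtains \<kappa> v where "\<kappa> > 0" "\<And>x. v x > 0" "\<And>x. trans_op Q v x = \<kappa> * v x"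
proof -
  obtain k where k: "k \<ge> 1"
    and pos: "\<And>g i. (\<forall>x. 0 \<le> g x) \<Longrightarrow> (\<exists>x. g x \<noteq> 0) \<Longrightarrow> 0 < (trans_op Q ^^ k) g i"
    using prim unfolding primitive_env_def by metis
  define S :: "(real ^ 'x) set" where "S = {x. (\<forall>i. 0 \<le> x $ i) \<and> (\<Sum>i\<in>UNIV. x $ i) = 1}"
  define F :: "real ^ 'x \<Rightarrow> real ^ 'x" where "F = (\<lambda>x. \<chi> i. trans_op Q (($) x) i)"
  define f where "f = (\<lambda>x. (1 / (\<Sum>i\<in>UNIV. F x $ i)) *\<^sub>R F x)"
  have F_nonneg: "0 \<le> F x $ i" if "x \<in> S" for x i
    using that nonneg by (auto simp: F_def S_def trans_op_def intro!: sum_nonneg)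
  have nz: "\<exists>i. x $ i \<noteq> 0" if "x \<in> S" for x
  proof (rule ccontr)
    assume "\<not> ?thesis"
    then have "(\<Sum>i\<in>UNIV. x $ i) = 0" by simp
    with that show False by (simp add: S_def)
  qed
  have F_pos: "(\<Sum>i\<in>UNIV. F x $ i) > 0" if x: "x \<in> S" for x
  proof (rule ccontr)
    assume "\<not> ?thesis"
    then have "(\<Sum>i\<in>UNIV. F x $ i) = 0"
      using F_nonneg[OF x] by (meson not_less order_antisym sum_nonneg)
    then have "F x $ i = 0" for i using F_nonneg[OF x]
      by (subst (asm) sum_nonneg_eq_0_iff) auto
    then have zero: "trans_op Q (($) x) = (\<lambda>_. 0)" by (auto simp: F_def)
    have "(trans_op Q ^^ n) (\<lambda>_. 0) = (\<lambda>_. 0)" for n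
      by (induction n) (auto simp: trans_op_def)
    \<comment> \<open>This is where k \<ge> 1 in \<open>primitive_env\<close> matters: for k = 0 the
      iterate would be x itself and there would be no contradiction.\<close>
    then have "(trans_op Q ^^ k) (($) x) = (\<lambda>_. 0)"
      using k zero by (cases k) (auto simp: funpow_Suc_right simp del: funpow.simps)
    then show False using pos[of "($) x"] x nz[OF x] by (simp add: S_def)
  qed
  have bounded: "bounded S"
  proof (rule boundedI)
    fix x assume x: "x \<in> S"
    have "norm x \<le> (\<Sum>i\<in>UNIV. \<bar>x $ i\<bar>)" by (rule norm_le_l1_cart)
    also have "\<dots> = 1" using x by (auto simp: S_def)
    finally show "norm x \<le> 1" .
  qed
  have "closed S"
    unfolding S_def
    by (intro closed_Collect_conj closed_Collect_all closed_Collect_le closed_Collect_eq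
        continuous_intros)
  with bounded have "compact S" by (simp add: compact_eq_bounded_closed)
  moreover have "convex S"
    unfolding convex_def S_def
    by (auto simp: sum.distrib sum_distrib_left[symmetric])
  moreover have "S \<noteq> {}"
  proof -
    have "(\<chi> i. 1 / real CARD('x)) \<in> S" by (auto simp: S_def)
    then show ?thesis by blast
  qed
  moreover have "continuous_on S f"
    unfolding f_def F_def trans_op_def
    by (intro continuous_intros continuous_on_vec_lambda)
       (use F_pos in \<open>auto simp: F_def trans_op_def dest!: F_pos\<close>)
  moreover have "f \<in> S \<rightarrow> S"
    using F_nonneg F_pos
    by (auto simp: f_def S_def sum_divide_distrib[symmetric] less_imp_le)
      (metis (mono_tags, lifting) order_less_irrefl)
  ultimately obtain x where x: "x \<in> S" "f x = x" using brouwer by metis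
  define \<kappa> where "\<kappa> = (\<Sum>i\<in>UNIV. F x $ i)"
  have \<kappa>: "\<kappa> > 0" using F_pos[OF x(1)] by (simp add: \<kappa>_def)
  have eig: "trans_op Q (($) x) i = \<kappa> * x $ i" for i
  proof -
    have "x $ i = F x $ i / \<kappa>" using arg_cong[OF x(2), of "\<lambda>x. x $ i"] by (simp add: f_def \<kappa>_def)
    then show ?thesis using \<kappa> by (simp add: F_def field_simps)
  qed
  have "(trans_op Q ^^ n) (($) x) = (\<lambda>i. \<kappa> ^ n * x $ i)" for n
    by (rule trans_op_pow_eigenvector[OF eig])
  moreover have "(trans_op Q ^^ k) (($) x) i > 0" for i
  proof (rule pos)
    show "\<forall>i. 0 \<le> x $ i" using x(1) by (simp add: S_def)
    show "\<exists>i. x $ i \<noteq> 0" using nz x(1) by blast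
  qed
  ultimately have "x $ i > 0" for i using \<kappa> by (simp add: zero_less_mult_iff)
  then show ?thesis using that[of \<kappa> "($) x"] \<kappa> eig by blast
qed

section \<open>Doeblin contraction and the limit of matrix powers\<close>

text \<open>The k-step law gives mass at least \<epsilon> to a maximiser of g, and the remaining
  mass sees at least the minimum of g.\<close>

lemma doeblin_lower_bound:
  fixes T :: "'x::finite \<Rightarrow> 'x \<Rightarrow> real"
  assumes one: "\<And>x. trans_op T (\<lambda>_. 1) x = 1"
    and low: "\<And>i j. \<epsilon> \<le> (trans_op T ^^ k) (indicat_real {j}) i" and "\<epsilon> > 0"
  shows "Min (range g) + \<epsilon> * (Max (range g) - Min (range g)) \<le> (trans_op T ^^ k) g i"
proof -
  let ?K = "\<lambda>j. (trans_op T ^^ k) (indicat_real {j}) i"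
  let ?m = "Min (range g)"
  have "(trans_op T ^^ n) (\<lambda>_. 1) = (\<lambda>_. 1)" for n
    by (induction n) (auto simp: one)
  then have sum1: "(\<Sum>j\<in>UNIV. ?K j) = 1"
    using trans_op_pow_expand[of k T "\<lambda>_. 1" i] by simp
  obtain j0 where j0: "g j0 = Max (range g)"
    using Max_in[of "range g"] by fastforce
  have m_le: "?m \<le> g j" for j by (rule Min_le) auto
  have "\<epsilon> * (g j0 - ?m) \<le> ?K j0 * (g j0 - ?m)"
    using low m_le by (intro mult_right_mono) auto
  also have "\<dots> \<le> (\<Sum>j\<in>UNIV. ?K j * (g j - ?m))"
    using low \<open>\<epsilon> > 0\<close> m_le
    by (intro member_le_sum) (auto intro!: mult_nonneg_nonneg dest: order_trans[OF less_imp_le])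
  also have "\<dots> = (\<Sum>j\<in>UNIV. ?K j * g j) - (\<Sum>j\<in>UNIV. ?K j) * ?m"
    by (simp add: right_diff_distrib sum_subtractf sum_distrib_right)
  also have "\<dots> = (trans_op T ^^ k) g i - ?m"
    by (simp add: sum1 trans_op_pow_expand[of k T g])
  finally show ?thesis by (simp add: j0)
qed

text \<open>The minimum of the n-th iterate increases with n and the maximum decreases, so both
  converge. Every k steps the minimum gains a fixed fraction of the oscillation; in the limit this
  gain must be zero, which forces the two limits to coincide.\<close>

lemma stochastic_primitive_limit:
  fixes T :: "'x::finite \<Rightarrow> 'x \<Rightarrow> real"
  assumes nonneg: "\<And>x y. 0 \<le> T x y" and one: "\<And>x. trans_op T (\<lambda>_. 1) x = 1"
    and prim: "primitive_env T"
  obtains L where "\<And>i. (\<lambda>n. (trans_op T ^^ n) g i) \<longlonglongrightarrow> L"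
proof -
  obtain k \<epsilon> where \<epsilon>: "\<epsilon> > 0"
    and low: "\<And>i j. \<epsilon> \<le> (trans_op T ^^ k) (indicat_real {j}) i"
    using primitive_entries_bounded_below[OF prim] by metis
  define G where "G = (\<lambda>n. (trans_op T ^^ n) g)"
  define lo hi where "lo = (\<lambda>n. Min (range (G n)))" and "hi = (\<lambda>n. Max (range (G n)))"
  have lo_le: "lo n \<le> G n i" for n i unfolding lo_def by (rule Min_le) auto
  have le_hi: "G n i \<le> hi n" for n i unfolding hi_def by (rule Max_ge) auto
  have const: "trans_op T (\<lambda>_. c) x = c" for c x
    using trans_op_scale[of T c "\<lambda>_. 1"] one by (auto simp: fun_eq_iff)
  have G_Suc: "G (Suc n) = trans_op T (G n)" for n by (simp add: G_def)
  have "lo n \<le> G (Suc n) i" for n i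
    using trans_op_mono[of T "\<lambda>_. lo n" "G n" i] nonneg lo_le by (simp add: const G_Suc)
  then have "incseq lo" by (intro incseq_SucI) (auto simp: lo_def)
  have "G (Suc n) i \<le> hi n" for n i
    using trans_op_mono[of T "G n" "\<lambda>_. hi n" i] nonneg le_hi by (simp add: const G_Suc)
  then have "decseq hi" by (intro decseq_SucI) (auto simp: hi_def)
  have lohi: "lo n \<le> hi n" for n using lo_le[of n undefined] le_hi[of n undefined] by linarith
  have lob: "lo n \<le> hi 0" for n
    using lohi[of n] decseqD[OF \<open>decseq hi\<close>, of 0 n] by simp
  have hib: "lo 0 \<le> hi n" for n
    using lohi[of n] incseqD[OF \<open>incseq lo\<close>, of 0 n] by simp
  obtain l where l: "lo \<longlonglongrightarrow> l" using incseq_convergent[OF \<open>incseq lo\<close>, of "hi 0"] lob by blast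
  obtain h where h: "hi \<longlonglongrightarrow> h" using decseq_convergent[OF \<open>decseq hi\<close>, of "lo 0"] hib by blast
  have contr: "lo n + \<epsilon> * (hi n - lo n) \<le> lo (n + k)" for n
  proof -
    have eq: "G (n + k) = (trans_op T ^^ k) (G n)"
      by (simp add: G_def add.commute[of n] funpow_add)
    have "lo n + \<epsilon> * (hi n - lo n) \<le> G (n + k) i" for i
      unfolding eq lo_def hi_def by (rule doeblin_lower_bound[OF one low \<epsilon>])
    then show ?thesis by (subst (3) lo_def) simp
  qed
  have "l + \<epsilon> * (h - l) \<le> l"
  proof (rule LIMSEQ_le)
    show "(\<lambda>n. lo n + \<epsilon> * (hi n - lo n)) \<longlonglongrightarrow> l + \<epsilon> * (h - l)"
      by (intro tendsto_intros l h)
    show "(\<lambda>n. lo (n + k)) \<longlonglongrightarrow> l" using l by (rule LIMSEQ_ignore_initial_segment)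
  qed (use contr in auto)
  with \<epsilon> have "h \<le> l" by (simp add: mult_le_0_iff)
  moreover have "l \<le> h" by (rule LIMSEQ_le[OF l h]) (use lohi in auto)
  ultimately have "h = l" by simp
  have "(\<lambda>n. G n i) \<longlonglongrightarrow> l" for i
    by (rule real_tendsto_sandwich[OF _ _ l h[unfolded \<open>h = l\<close>]]) (use lo_le le_hi in auto)
  then show ?thesis by (intro that[of l]) (simp add: G_def)
qed

text \<open>This is the Doob transform: conjugation by the diagonal matrix of v and division by
  \<kappa>, so the factors v telescope along a power. If v is an eigenvector for \<kappa>, the
  transformed matrix is stochastic.\<close>

lemma trans_op_pow_similar:
  fixes Q :: "'x::finite \<Rightarrow> 'x \<Rightarrow> real"
  assumes "\<kappa> > 0" "\<And>x. v x > 0"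
  shows "(trans_op (\<lambda>x y. Q x y * (v y / (\<kappa> * v x))) ^^ n) g x
    = (trans_op Q ^^ n) (\<lambda>y. v y * g y) x / (\<kappa> ^ n * v x)"
proof (induction n arbitrary: x)
  case 0
  show ?case using assms(2)[of x] by simp
next
  case (Suc n)
  have nz: "v y \<noteq> 0" for y using assms(2)[of y] by simp
  define T where "T = (\<lambda>x y. Q x y * (v y / (\<kappa> * v x)))"
  have step: "trans_op T (\<lambda>y. H y / (\<kappa> ^ n * v y)) x = trans_op Q H x / (\<kappa> ^ Suc n * v x)" for H
    unfolding trans_op_def sum_divide_distrib
    using nz \<open>\<kappa> > 0\<close> by (intro sum.cong) (auto simp: T_def field_simps)
  have "(trans_op T ^^ n) g = (\<lambda>y. (trans_op Q ^^ n) (\<lambda>y. v y * g y) y / (\<kappa> ^ n * v y))"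
    using Suc.IH by (simp add: T_def fun_eq_iff)
  then show ?case unfolding T_def[symmetric] by (simp add: step)
qed

text \<open>The Doob transform \<open>T\<close> has a stationary law \<open>L\<close>, the common
  limit of the rows of its powers; undoing the transform gives the left eigenvector w = L / v. Its
  eigenvector equation is part of the conclusion because the derivative of the Perron root is
  computed by pairing with w.\<close>

lemma primitive_power_asymptotics:
  fixes Q :: "'x::finite \<Rightarrow> 'x \<Rightarrow> real"
  assumes nonneg: "\<And>x y. 0 \<le> Q x y" and prim: "primitive_env Q"
    and \<kappa>: "\<kappa> > 0" and v: "\<And>x. v x > 0" and eig: "\<And>x. trans_op Q v x = \<kappa> * v x"
  obtains w where "\<And>j. w j > 0"
    and "\<And>g i. (\<lambda>n. (trans_op Q ^^ n) g i / \<kappa> ^ n) \<longlonglongrightarrow> v i * (\<Sum>j\<in>UNIV. w j * g j)"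
    and "\<And>g. (\<Sum>i\<in>UNIV. w i * trans_op Q g i) = \<kappa> * (\<Sum>i\<in>UNIV. w i * g i)"
proof -
  define T where "T = (\<lambda>x y. Q x y * (v y / (\<kappa> * v x)))"
  have T_nonneg: "0 \<le> T x y" for x y
    using nonneg \<kappa> v by (auto simp: T_def less_imp_le)
  have T_prim: "primitive_env T"
    unfolding T_def by (rule primitive_env_scale_entries[OF nonneg prim]) (use \<kappa> v in auto)
  have T_pow: "(trans_op T ^^ n) g x = (trans_op Q ^^ n) (\<lambda>y. v y * g y) x / (\<kappa> ^ n * v x)" for n g x
    unfolding T_def by (rule trans_op_pow_similar[OF \<kappa> v])
  have T_one: "trans_op T (\<lambda>_. 1) x = 1" for x
    using T_pow[of 1 "\<lambda>_. 1" x] eig[of x] \<kappa> v[of x] by simp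
  obtain k \<epsilon> where \<epsilon>: "\<epsilon> > 0" and low: "\<And>i j. \<epsilon> \<le> (trans_op T ^^ k) (indicat_real {j}) i"
    using primitive_entries_bounded_below[OF T_prim] by metis
  have "\<forall>j. \<exists>L. \<forall>i. (\<lambda>n. (trans_op T ^^ n) (indicat_real {j}) i) \<longlonglongrightarrow> L"
    using stochastic_primitive_limit[OF T_nonneg T_one T_prim] by metis
  then obtain L where L: "\<And>i j. (\<lambda>n. (trans_op T ^^ n) (indicat_real {j}) i) \<longlonglongrightarrow> L j"
    by metis
  have T_const: "(trans_op T ^^ n) (\<lambda>_. c) x = c" for n c x
  proof (induction n arbitrary: x)
    case (Suc n)
    have "(trans_op T ^^ n) (\<lambda>_. c) = (\<lambda>_. c)" using Suc by auto
    moreover have "trans_op T (\<lambda>_. c) x = c"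
      using trans_op_scale[of T c "\<lambda>_. 1"] T_one by (simp add: fun_eq_iff)
    ultimately show ?case by simp
  qed simp
  \<comment> \<open>Each row of the (n+k)-th power is an average of rows of the k-th power, so the
    Doeblin constant survives in the limit and every state is charged.\<close>
  have "\<epsilon> \<le> L j" for j
  proof (rule LIMSEQ_le_const)
    show "(\<lambda>n. (trans_op T ^^ (n + k)) (indicat_real {j}) undefined) \<longlonglongrightarrow> L j"
      using L by (rule LIMSEQ_ignore_initial_segment)
    have "\<epsilon> \<le> (trans_op T ^^ (n + k)) (indicat_real {j}) undefined" for n
    proof -
      have "(trans_op T ^^ n) (\<lambda>_. \<epsilon>) undefined
          \<le> (trans_op T ^^ n) ((trans_op T ^^ k) (indicat_real {j})) undefined"
        by (rule trans_op_pow_mono[OF T_nonneg low])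
      then show ?thesis by (simp add: T_const funpow_add)
    qed
    then show "\<exists>N. \<forall>n\<ge>N. \<epsilon> \<le> (trans_op T ^^ (n + k)) (indicat_real {j}) undefined" by blast
  qed
  then have L_pos: "L j > 0" for j using \<epsilon> by (meson less_le_trans)
  define w where "w = (\<lambda>j. L j / v j)"
  have w_pos: "w j > 0" for j using L_pos v by (simp add: w_def)
  have lim: "(\<lambda>n. (trans_op Q ^^ n) g i / \<kappa> ^ n) \<longlonglongrightarrow> v i * (\<Sum>j\<in>UNIV. w j * g j)" for g i
  proof -
    have "(\<lambda>n. v i * (\<Sum>j\<in>UNIV. (trans_op T ^^ n) (indicat_real {j}) i * (g j / v j)))
        \<longlonglongrightarrow> v i * (\<Sum>j\<in>UNIV. L j * (g j / v j))"
      by (intro tendsto_intros L)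
    moreover have "v i * (\<Sum>j\<in>UNIV. (trans_op T ^^ n) (indicat_real {j}) i * (g j / v j))
        = (trans_op Q ^^ n) g i / \<kappa> ^ n" for n
    proof -
      have "v y * (g y / v y) = g y" for y using v[of y] by simp
      then show ?thesis
        using v[of i] by (subst trans_op_pow_expand[symmetric]) (simp add: T_pow)
    qed
    ultimately show ?thesis by (simp add: w_def)
  qed
  have "(\<Sum>i\<in>UNIV. w i * trans_op Q g i) = \<kappa> * (\<Sum>i\<in>UNIV. w i * g i)" for g
  proof -
    let ?i = undefined
    \<comment> \<open>The limit of the power n+1 applied to g is computed in two ways. The start
      state is arbitrary, since its factor v cancels.\<close>
    have "(\<lambda>n. \<kappa> * ((trans_op Q ^^ Suc n) g ?i / \<kappa> ^ Suc n)) \<longlonglongrightarrow> \<kappa> * (v ?i * (\<Sum>j\<in>UNIV. w j * g j))"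
      by (intro tendsto_intros LIMSEQ_Suc lim)
    moreover have "\<kappa> * ((trans_op Q ^^ Suc n) g ?i / \<kappa> ^ Suc n)
        = (trans_op Q ^^ n) (trans_op Q g) ?i / \<kappa> ^ n" for n
      using \<kappa> by (simp add: funpow_swap1)
    ultimately have "\<kappa> * (v ?i * (\<Sum>j\<in>UNIV. w j * g j)) = v ?i * (\<Sum>j\<in>UNIV. w j * trans_op Q g j)"
      using lim[of "trans_op Q g" ?i] by (intro LIMSEQ_unique) auto
    then show ?thesis using v[of ?i] by simp
  qed
  with w_pos lim that show ?thesis by blast
qed

section \<open>The Perron root as a growth rate and as a function of the parameter\<close>

text \<open>Divided by \<open>\<kappa> ^ n\<close>, the total mass tends to a positive number, whose
  n-th root tends to 1. This is how the limit defining k is recognised as an eigenvalue.\<close>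

lemma perron_power_root:
  fixes Q :: "'x::finite \<Rightarrow> 'x \<Rightarrow> real"
  assumes nonneg: "\<And>x y. 0 \<le> Q x y" and prim: "primitive_env Q"
    and \<kappa>: "\<kappa> > 0" and v: "\<And>x. v x > 0" and eig: "\<And>x. trans_op Q v x = \<kappa> * v x"
  shows "(\<lambda>n. (trans_op Q ^^ n) (\<lambda>_. 1) i powr (1 / real n)) \<longlonglongrightarrow> \<kappa>"
proof -
  obtain w where w: "\<And>j. w j > 0"
    and lim: "\<And>g i. (\<lambda>n. (trans_op Q ^^ n) g i / \<kappa> ^ n) \<longlonglongrightarrow> v i * (\<Sum>j\<in>UNIV. w j * g j)"
    using primitive_power_asymptotics[OF assms] by metis
  define r S where "r = (\<lambda>n. (trans_op Q ^^ n) (\<lambda>_. 1) i / \<kappa> ^ n)" and "S = v i * (\<Sum>j\<in>UNIV. w j)"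
  have r: "r \<longlonglongrightarrow> S" using lim[of "\<lambda>_. 1" i] by (simp add: r_def S_def)
  have pos: "S > 0" unfolding S_def using v w by (simp add: sum_pos)
  have "(\<lambda>n. \<kappa> * r n powr (1 / real n)) \<longlonglongrightarrow> \<kappa> * S powr 0"
    using pos by (intro tendsto_intros r) (auto intro: lim_1_over_n)
  then have lim': "(\<lambda>n. \<kappa> * r n powr (1 / real n)) \<longlonglongrightarrow> \<kappa>" using pos by simp
  have ev: "eventually (\<lambda>n. r n > 0) sequentially" using order_tendstoD(1)[OF r pos] .
  show ?thesis
  proof (rule Lim_transform_eventually[OF lim'])
    show "eventually (\<lambda>n. \<kappa> * r n powr (1 / real n)
        = (trans_op Q ^^ n) (\<lambda>_. 1) i powr (1 / real n)) sequentially"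
      using ev eventually_gt_at_top[of 0]
    proof eventually_elim
      case (elim n)
      have "(trans_op Q ^^ n) (\<lambda>_. 1) i = \<kappa> ^ n * r n" using \<kappa> by (simp add: r_def)
      moreover have "(\<kappa> ^ n) powr (1 / real n) = \<kappa>"
        using \<kappa> elim by (simp add: powr_powr powr_realpow[symmetric])
      ultimately show ?case using elim \<kappa> by (simp add: powr_mult)
    qed
  qed
qed

text \<open>The constant function 1 is dominated by the eigenvector v / m. The resulting bound holds
  for every n and i, as the moment estimates require.\<close>

lemma perron_power_upper:
  fixes Q :: "'x::finite \<Rightarrow> 'x \<Rightarrow> real"
  assumes nonneg: "\<And>x y. 0 \<le> Q x y"
    and \<kappa>: "\<kappa> > 0" and v: "\<And>x. v x > 0" and eig: "\<And>x. trans_op Q v x = \<kappa> * v x"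
  obtains C where "C > 0" "\<And>n i. (trans_op Q ^^ n) (\<lambda>_. 1) i \<le> C * \<kappa> ^ n"
proof -
  define m M where "m = Min (range v)" and "M = Max (range v)"
  have m: "m > 0" unfolding m_def by (subst Min_gr_iff) (auto simp: v)
  have mv: "m \<le> v x" and vM: "v x \<le> M" for x unfolding m_def M_def by auto
  have eigs: "(trans_op Q ^^ n) v = (\<lambda>i. \<kappa> ^ n * v i)" for n
    by (rule trans_op_pow_eigenvector[OF eig])
  have "(trans_op Q ^^ n) (\<lambda>_. 1) i \<le> M / m * \<kappa> ^ n" for n i
  proof -
    have "(trans_op Q ^^ n) (\<lambda>_. 1) i \<le> (trans_op Q ^^ n) (\<lambda>x. 1 / m * v x) i"
      by (rule trans_op_pow_mono[OF nonneg]) (use m mv in auto)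
    also have "\<dots> = v i * \<kappa> ^ n / m" unfolding trans_op_pow_scale eigs by simp
    also have "\<dots> \<le> M * \<kappa> ^ n / m"
      using vM \<kappa> m by (intro divide_right_mono mult_right_mono) auto
    finally show ?thesis by simp
  qed
  moreover have "M / m > 0" using m mv vM by (meson divide_pos_pos less_le_trans)
  ultimately show ?thesis using that by blast
qed

text \<open>This yields the continuity of the Perron eigenvector in the tilting parameter.\<close>

lemma almost_superharmonic_oscillation:
  fixes T :: "'x::finite \<Rightarrow> 'x \<Rightarrow> real"
  assumes nonneg: "\<And>x y. 0 \<le> T x y" and one: "\<And>x. trans_op T (\<lambda>_. 1) x = 1"
    and low: "\<And>i j. \<epsilon> \<le> (trans_op T ^^ k) (indicat_real {j}) i" and \<epsilon>: "\<epsilon> > 0"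
    and c: "c \<ge> 0" and super: "\<And>x. trans_op T g x \<le> c * g x"
  shows "\<epsilon> * (Max (range g) - Min (range g)) \<le> (c ^ k - 1) * Min (range g)"
proof -
  have pow: "(trans_op T ^^ n) g x \<le> c ^ n * g x" for n x
  proof (induction n arbitrary: x)
    case (Suc n)
    have "(trans_op T ^^ Suc n) g x \<le> trans_op T (\<lambda>x. c ^ n * g x) x"
      by (simp add: trans_op_mono[OF nonneg Suc])
    also have "\<dots> \<le> c ^ n * (c * g x)"
      using super c by (simp add: trans_op_scale mult_left_mono)
    finally show ?case by (simp add: mult_ac)
  qed simp
  \<comment> \<open>At a minimiser the lower Doeblin bound meets the upper bound
    \<open>c ^ k * g\<close>; the gap between them limits the oscillation.\<close>
  obtain i where i: "g i = Min (range g)" using Min_in[of "range g"] by fastforce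
  have "Min (range g) + \<epsilon> * (Max (range g) - Min (range g)) \<le> (trans_op T ^^ k) g i"
    by (rule doeblin_lower_bound[OF one low \<epsilon>])
  also have "\<dots> \<le> c ^ k * Min (range g)" using pow[of k i] i by simp
  finally show ?thesis by (simp add: algebra_simps)
qed

text \<open>Pairing the eigenvector equation at t0 + h with the left eigenvector at t0 writes the
  difference quotient as \<kappa>(t0) times a weighted mean of (exp(h \<rho>) - 1) / h with weights
  proportional to s * g(h). The eigenvector is therefore never differentiated: it is enough that
  g(h) tends to 1, and this is what the oscillation estimate supplies.\<close>

lemma perron_root_differentiable:
  fixes P :: "'x::finite \<Rightarrow> 'x \<Rightarrow> real" and \<rho> :: "'x \<Rightarrow> real"
  assumes nonneg: "\<And>x y. 0 \<le> P x y" and prim: "primitive_env P"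
    and \<kappa>: "\<And>t. \<kappa> t > 0" and v: "\<And>t x. v t x > 0"
    and eig: "\<And>t x. trans_op (\<lambda>x y. P x y * exp (t * \<rho> y)) (v t) x = \<kappa> t * v t x"
  shows "\<exists>D. (\<kappa> has_real_derivative D) (at t0)"
proof -
  define Q where "Q = (\<lambda>x y. P x y * exp (t0 * \<rho> y))"
  have Q_nonneg: "0 \<le> Q x y" for x y using nonneg by (simp add: Q_def)
  have Q_prim: "primitive_env Q"
    unfolding Q_def by (rule primitive_env_scale_entries[OF nonneg prim]) simp
  have Q_eig: "trans_op Q (v t0) x = \<kappa> t0 * v t0 x" for x
    unfolding Q_def by (rule eig)
  define T where "T = (\<lambda>x y. Q x y * (v t0 y / (\<kappa> t0 * v t0 x)))"
  have T_nonneg: "0 \<le> T x y" for x y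
    using Q_nonneg \<kappa> v by (auto simp: T_def less_imp_le)
  have T_prim: "primitive_env T"
    unfolding T_def by (rule primitive_env_scale_entries[OF Q_nonneg Q_prim]) (use \<kappa> v in auto)
  have T_op: "trans_op T g x = trans_op Q (\<lambda>y. v t0 y * g y) x / (\<kappa> t0 * v t0 x)" for g x
    using trans_op_pow_similar[of "\<kappa> t0" "v t0" 1 Q g x] \<kappa> v by (simp add: T_def)
  have T_one: "trans_op T (\<lambda>_. 1) x = 1" for x
    using T_op[of "\<lambda>_. 1" x] Q_eig[of x] \<kappa>[of t0] v[of t0 x] by simp
  obtain k \<epsilon> where \<epsilon>: "\<epsilon> > 0" and low: "\<And>i j. \<epsilon> \<le> (trans_op T ^^ k) (indicat_real {j}) i"
    using primitive_entries_bounded_below[OF T_prim] by metis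
  obtain w where w: "\<And>j. w j > 0"
    and left: "\<And>g. (\<Sum>i\<in>UNIV. w i * trans_op Q g i) = \<kappa> t0 * (\<Sum>i\<in>UNIV. w i * g i)"
    using primitive_power_asymptotics[OF Q_nonneg Q_prim \<kappa> v Q_eig] by metis
  define q where "q = (\<lambda>h y. v (t0 + h) y / v t0 y)"
  \<comment> \<open>An eigenvector is only fixed up to a factor, which may jump with the parameter.
    Scaling the ratio of the two eigenvectors to minimum 1 removes this freedom.\<close>
  define g where "g = (\<lambda>h y. q h y / Min (range (q h)))"
  \<comment> \<open>Up to a factor this is the stationary law of \<open>T\<close>, so the derivative
    comes out as \<kappa>(t0) times the mean of \<rho> under that law.\<close>
  define s where "s = (\<lambda>j. w j * v t0 j)"
  have s: "s j > 0" for j using w v by (simp add: s_def)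
  have q_pos: "q h y > 0" for h y using v by (simp add: q_def)
  have minq: "Min (range (q h)) > 0" for h by (subst Min_gr_iff) (auto simp: q_pos)
  have g_pos: "g h y > 0" for h y using q_pos minq by (simp add: g_def)
  have g_ge: "1 \<le> g h y" for h y using minq[of h] by (simp add: g_def)
  have g_min: "Min (range (g h)) = 1" for h
  proof -
    obtain i where "q h i = Min (range (q h))" using Min_in[of "range (q h)"] by fastforce
    moreover have "Min (range (q h)) \<noteq> 0" using minq[of h] by linarith
    ultimately have "g h i = 1" by (simp add: g_def)
    then show ?thesis by (intro Min_eqI) (auto simp: g_ge intro: image_eqI[of _ _ i])
  qed
  have sg: "(\<Sum>j\<in>UNIV. s j * g h j) > 0" for h using s g_pos by (intro sum_pos) auto
  have g_eig: "trans_op Q (\<lambda>y. exp (h * \<rho> y) * (v t0 y * g h y)) x = \<kappa> (t0 + h) * (v t0 x * g h x)" for h x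
  proof -
    have vg: "v t0 y * g h y = 1 / Min (range (q h)) * v (t0 + h) y" for y
      using v[of t0 y] by (simp add: g_def q_def)
    have e: "exp ((t0 + h) * \<rho> y) = exp (h * \<rho> y) * exp (t0 * \<rho> y)" for y
      by (simp add: distrib_right exp_add)
    have "trans_op Q (\<lambda>y. exp (h * \<rho> y) * (v t0 y * g h y)) x
        = trans_op (\<lambda>x y. P x y * exp ((t0 + h) * \<rho> y)) (\<lambda>y. 1 / Min (range (q h)) * v (t0 + h) y) x"
      unfolding trans_op_def Q_def vg e by (simp add: mult_ac)
    also have "\<dots> = \<kappa> (t0 + h) * (v t0 x * g h x)"
      unfolding trans_op_scale vg using eig[of "t0 + h" x] by simp
    finally show ?thesis .
  qed
  have ratio: "\<kappa> t0 * (\<Sum>j\<in>UNIV. s j * (exp (h * \<rho> j) * g h j)) = \<kappa> (t0 + h) * (\<Sum>j\<in>UNIV. s j * g h j)" for h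
    using left[of "\<lambda>y. exp (h * \<rho> y) * (v t0 y * g h y)"]
    unfolding g_eig by (simp add: s_def sum_distrib_left mult_ac)
  define R where "R = Max (range (\<lambda>j. \<bar>\<rho> j\<bar>))"
  have R: "\<bar>\<rho> j\<bar> \<le> R" for j unfolding R_def by (rule Max_ge) auto
  have hR: "h * \<rho> j \<le> R * \<bar>h\<bar>" "- (R * \<bar>h\<bar>) \<le> h * \<rho> j" for h j
  proof -
    have "\<bar>h * \<rho> j\<bar> \<le> R * \<bar>h\<bar>"
      using mult_left_mono[OF R[of j], of "\<bar>h\<bar>"] by (simp add: abs_mult mult.commute)
    then show "h * \<rho> j \<le> R * \<bar>h\<bar>" "- (R * \<bar>h\<bar>) \<le> h * \<rho> j" by linarith+
  qed
  have \<kappa>_le: "\<kappa> (t0 + h) \<le> exp (R * \<bar>h\<bar>) * \<kappa> t0" for h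
  proof -
    have "(\<Sum>j\<in>UNIV. s j * (exp (h * \<rho> j) * g h j)) \<le> (\<Sum>j\<in>UNIV. s j * (exp (R * \<bar>h\<bar>) * g h j))"
      using s g_pos hR by (intro sum_mono mult_left_mono mult_right_mono) (auto simp: less_imp_le)
    also have "\<dots> = exp (R * \<bar>h\<bar>) * (\<Sum>j\<in>UNIV. s j * g h j)"
      by (simp add: sum_distrib_left mult_ac)
    finally have "\<kappa> (t0 + h) * (\<Sum>j\<in>UNIV. s j * g h j)
        \<le> exp (R * \<bar>h\<bar>) * \<kappa> t0 * (\<Sum>j\<in>UNIV. s j * g h j)"
      unfolding ratio[symmetric] using \<kappa>[of t0] by (simp add: mult_left_mono mult_ac)
    then show ?thesis using sg[of h] by simp
  qed
  \<comment> \<open>One factor exp(R |h|) comes from removing the tilt by h and another from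
    \<open>\<kappa>_le\<close>. Thus \<open>g h\<close> is superharmonic for \<open>T\<close> up to
    a factor tending to 1.\<close>
  have super: "trans_op T (g h) x \<le> exp (2 * R * \<bar>h\<bar>) * g h x" for h x
  proof -
    have "trans_op Q (\<lambda>y. v t0 y * g h y) x
        \<le> trans_op Q (\<lambda>y. exp (R * \<bar>h\<bar>) * (exp (h * \<rho> y) * (v t0 y * g h y))) x"
    proof (rule trans_op_mono[OF Q_nonneg])
      fix y
      have "1 \<le> exp (R * \<bar>h\<bar>) * exp (h * \<rho> y)"
        using hR(2)[of h y] by (simp add: exp_add[symmetric])
      then have "1 * (v t0 y * g h y) \<le> exp (R * \<bar>h\<bar>) * exp (h * \<rho> y) * (v t0 y * g h y)"
        using v g_pos by (intro mult_right_mono) (auto simp: less_imp_le)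
      then show "v t0 y * g h y \<le> exp (R * \<bar>h\<bar>) * (exp (h * \<rho> y) * (v t0 y * g h y))"
        by (simp add: mult_ac)
    qed
    also have "\<dots> = exp (R * \<bar>h\<bar>) * \<kappa> (t0 + h) * (v t0 x * g h x)"
      by (simp add: trans_op_scale[of Q "exp (R * \<bar>h\<bar>)"] g_eig)
    also have "\<dots> \<le> exp (R * \<bar>h\<bar>) * (exp (R * \<bar>h\<bar>) * \<kappa> t0) * (v t0 x * g h x)"
      using v g_pos \<kappa>_le by (intro mult_right_mono mult_left_mono) (auto simp: less_imp_le)
    also have "\<dots> = exp (2 * R * \<bar>h\<bar>) * g h x * (\<kappa> t0 * v t0 x)"
    proof -
      have "exp (2 * R * \<bar>h\<bar>) = exp (R * \<bar>h\<bar>) * exp (R * \<bar>h\<bar>)" by (simp add: exp_add[symmetric])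
      then show ?thesis by (simp add: mult_ac)
    qed
    finally show ?thesis using \<kappa>[of t0] v[of t0 x] by (simp add: T_op divide_le_eq)
  qed
  have g_le: "g h y \<le> 1 + (exp (2 * R * \<bar>h\<bar>) ^ k - 1) / \<epsilon>" for h y
  proof -
    have "\<epsilon> * (Max (range (g h)) - 1) \<le> exp (2 * R * \<bar>h\<bar>) ^ k - 1"
      using almost_superharmonic_oscillation[OF T_nonneg T_one low \<epsilon> _ super[of h]] g_min by simp
    then have "Max (range (g h)) \<le> 1 + (exp (2 * R * \<bar>h\<bar>) ^ k - 1) / \<epsilon>"
      using \<epsilon> by (simp add: field_simps)
    moreover have "g h y \<le> Max (range (g h))" by (rule Max_ge) auto
    ultimately show ?thesis by linarith
  qed
  have g_lim: "((\<lambda>h. g h y) \<longlongrightarrow> 1) (at 0)" for y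
  proof (rule real_tendsto_sandwich)
    show "((\<lambda>h. 1) \<longlongrightarrow> (1::real)) (at (0::real))" by simp
    have "((\<lambda>h. 1 + (exp (2 * R * \<bar>h\<bar>) ^ k - 1) / \<epsilon>) \<longlongrightarrow> 1 + (exp (2 * R * \<bar>0\<bar>) ^ k - 1) / \<epsilon>) (at 0)"
      using \<epsilon> by (intro tendsto_intros) auto
    then show "((\<lambda>h. 1 + (exp (2 * R * \<bar>h\<bar>) ^ k - 1) / \<epsilon>) \<longlongrightarrow> 1) (at 0)" by simp
  qed (auto simp: g_ge g_le)
  have e_lim: "((\<lambda>h. (exp (h * \<rho> j) - 1) / h) \<longlongrightarrow> \<rho> j) (at 0)" for j
  proof -
    have "((\<lambda>h. exp (h * \<rho> j)) has_real_derivative \<rho> j) (at 0)"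
      by (auto intro!: derivative_eq_intros)
    then show ?thesis by (simp add: DERIV_def)
  qed
  have lim: "((\<lambda>h. \<kappa> t0 * (\<Sum>j\<in>UNIV. s j * ((exp (h * \<rho> j) - 1) / h * g h j)) / (\<Sum>j\<in>UNIV. s j * g h j))
      \<longlongrightarrow> \<kappa> t0 * (\<Sum>j\<in>UNIV. s j * (\<rho> j * 1)) / (\<Sum>j\<in>UNIV. s j * 1)) (at 0)"
  proof -
    have "(\<Sum>j\<in>UNIV. s j) > 0" using s by (intro sum_pos) auto
    then show ?thesis by (intro tendsto_intros g_lim e_lim) auto
  qed
  have "((\<lambda>h. (\<kappa> (t0 + h) - \<kappa> t0) / h) \<longlongrightarrow> \<kappa> t0 * (\<Sum>j\<in>UNIV. s j * (\<rho> j * 1)) / (\<Sum>j\<in>UNIV. s j * 1)) (at 0)"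
  proof (rule Lim_transform_eventually[OF lim], rule always_eventually, rule allI)
    fix h
    let ?D = "\<Sum>j\<in>UNIV. s j * g h j"
    have "\<kappa> t0 * (\<Sum>j\<in>UNIV. s j * ((exp (h * \<rho> j) - 1) / h * g h j))
        = \<kappa> t0 * ((\<Sum>j\<in>UNIV. s j * (exp (h * \<rho> j) * g h j)) - ?D) / h"
      by (simp add: sum_subtractf[symmetric] sum_divide_distrib sum_distrib_left algebra_simps
          diff_divide_distrib)
    also have "\<dots> = (\<kappa> (t0 + h) - \<kappa> t0) / h * ?D"
      by (simp add: right_diff_distrib ratio left_diff_distrib diff_divide_distrib)
    finally show "\<kappa> t0 * (\<Sum>j\<in>UNIV. s j * ((exp (h * \<rho> j) - 1) / h * g h j)) / ?D
        = (\<kappa> (t0 + h) - \<kappa> t0) / h"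
      using sg[of h] by simp
  qed
  then show ?thesis unfolding DERIV_def by blast
qed

section \<open>The law of the branching process in a fixed environment\<close>

text \<open>Truncation to Y < n and dominated convergence. With Y the size of a generation and
  \<open>H k\<close> the power of s to the total offspring of k individuals, this decomposes the
  next generation according to the size of the current one.\<close>

lemma (in prob_space) expectation_stopped_sums:
  fixes Y :: "'a \<Rightarrow> nat" and H :: "nat \<Rightarrow> 'a \<Rightarrow> real"
  assumes Y[measurable]: "Y \<in> measurable M (count_space UNIV)"
    and H[measurable]: "\<And>k. H k \<in> borel_measurable M" and bd: "\<And>k \<omega>. \<bar>H k \<omega>\<bar> \<le> 1"
  shows "(\<lambda>k. expectation (\<lambda>\<omega>. indicator {k} (Y \<omega>) * H k \<omega>)) sums expectation (\<lambda>\<omega>. H (Y \<omega>) \<omega>)"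
proof -
  have int: "integrable M (\<lambda>\<omega>. indicator {k} (Y \<omega>) * H k \<omega>)" for k
  proof (rule integrable_const_bound[of _ 1])
    show "AE \<omega> in M. norm (indicat_real {k} (Y \<omega>) * H k \<omega>) \<le> 1"
      using bd by (auto simp: indicator_def)
    show "(\<lambda>\<omega>. indicat_real {k} (Y \<omega>) * H k \<omega>) \<in> borel_measurable M"
      by (intro borel_measurable_times H measurable_compose[OF Y]) simp
  qed
  have partial: "(\<Sum>k<n. indicator {k} (Y \<omega>) * H k \<omega>) = (if Y \<omega> < n then H (Y \<omega>) \<omega> else 0)" for n \<omega>
    by (induction n) (auto simp: indicator_def less_Suc_eq)
  have "(\<lambda>n. expectation (\<lambda>\<omega>. if Y \<omega> < n then H (Y \<omega>) \<omega> else 0)) \<longlonglongrightarrow> expectation (\<lambda>\<omega>. H (Y \<omega>) \<omega>)"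
  proof (rule integral_dominated_convergence[where w = "\<lambda>_. 1"])
    show [measurable]: "(\<lambda>\<omega>. H (Y \<omega>) \<omega>) \<in> borel_measurable M"
      by (rule measurable_compose_countable[OF H Y])
    show "(\<lambda>\<omega>. if Y \<omega> < n then H (Y \<omega>) \<omega> else 0) \<in> borel_measurable M" for n
      by measurable
    have "(\<lambda>n. if Y \<omega> < n then H (Y \<omega>) \<omega> else 0) \<longlonglongrightarrow> H (Y \<omega>) \<omega>" for \<omega>
      by (rule tendsto_eventually)
        (rule eventually_mono[OF eventually_gt_at_top[of "Y \<omega>"]], simp)
    then show "AE \<omega> in M. (\<lambda>n. if Y \<omega> < n then H (Y \<omega>) \<omega> else 0) \<longlonglongrightarrow> H (Y \<omega>) \<omega>"
      by simp
    show "AE \<omega> in M. norm (if Y \<omega> < n then H (Y \<omega>) \<omega> else 0) \<le> 1" for n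
      using bd by auto
  qed simp
  then show ?thesis
    unfolding sums_def partial[symmetric] by (subst (asm) Bochner_Integration.integral_sum[OF int])
qed

lemma (in prob_space) generating_function_sums:
  fixes Y :: "'a \<Rightarrow> nat" and s :: real
  assumes Y[measurable]: "Y \<in> measurable M (count_space UNIV)" and s: "\<bar>s\<bar> \<le> 1"
  shows "(\<lambda>k. \<P>(\<omega> in M. Y \<omega> = k) * s ^ k) sums expectation (\<lambda>\<omega>. s ^ Y \<omega>)"
proof -
  have "(\<lambda>k. expectation (\<lambda>\<omega>. indicator {k} (Y \<omega>) * s ^ k)) sums expectation (\<lambda>\<omega>. s ^ Y \<omega>)"
    by (rule expectation_stopped_sums[OF Y]) (use s in \<open>auto simp: power_abs power_le_one\<close>)
  moreover have "expectation (\<lambda>\<omega>. indicator {k} (Y \<omega>) * s ^ k) = \<P>(\<omega> in M. Y \<omega> = k) * s ^ k" for k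
  proof -
    have "expectation (\<lambda>\<omega>. indicator {k} (Y \<omega>) * s ^ k)
        = expectation (indicator {\<omega> \<in> space M. Y \<omega> = k}) * s ^ k"
      by (subst integral_mult_left_zero[symmetric], intro Bochner_Integration.integral_cong)
        (auto simp: indicator_def)
    then show ?thesis by simp
  qed
  ultimately show ?thesis by (simp only:)
qed

text \<open>Once the coefficients below n agree, dividing the difference of the series by s^n and
  letting s tend to 0 isolates the coefficients of index n.\<close>

lemma powser_coeffs_unique:
  fixes c d :: "nat \<Rightarrow> real"
  assumes eq: "\<And>s. \<bar>s\<bar> < 1 \<Longrightarrow> \<exists>y. (\<lambda>n. c n * s ^ n) sums y \<and> (\<lambda>n. d n * s ^ n) sums y"
  shows "c n = d n"
proof (induction n rule: less_induct)
  case (less n)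
  have "((\<lambda>_. 0) \<longlongrightarrow> c (0 + n) - d (0 + n)) (at (0::real))"
  proof (rule powser_limit_0_strong[of 1 "\<lambda>k. c (k + n) - d (k + n)"])
    fix s :: real assume s: "s \<noteq> 0" "norm s < 1"
    obtain y where y: "(\<lambda>n. c n * s ^ n) sums y" "(\<lambda>n. d n * s ^ n) sums y"
      using eq[of s] s by auto
    have "(\<lambda>k. (c k - d k) * s ^ k) sums 0"
      using sums_diff[OF y] by (simp add: left_diff_distrib)
    then have "(\<lambda>k. (c (k + n) - d (k + n)) * s ^ (k + n)) sums (0 - (\<Sum>k<n. (c k - d k) * s ^ k))"
      by (rule sums_split_initial_segment)
    moreover have "(\<Sum>k<n. (c k - d k) * s ^ k) = 0"
      using less by (intro sum.neutral) auto
    ultimately have "(\<lambda>k. s ^ n * ((c (k + n) - d (k + n)) * s ^ k)) sums (s ^ n * 0)"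
      by (simp add: power_add mult_ac)
    then show "(\<lambda>k. (c (k + n) - d (k + n)) * s ^ k) sums 0"
      by (rule iffD1[OF sums_mult_iff, rotated]) (use s in simp)
  qed simp
  then show ?case using tendsto_const_iff[of "at (0::real)" 0 "c n - d n"] by simp
qed

text \<open>Negative arguments are included because the comparison of coefficients uses a two-sided
  neighbourhood of 0.\<close>

lemma lf_mass_sums_lf_gf_abs:
  fixes a p s :: real
  assumes "0 < p" "p < 1" "\<bar>s\<bar> \<le> 1"
  shows "(\<lambda>k. lf_mass a p k * s ^ k) sums lf_gf a p s"
proof -
  have "\<bar>p * s\<bar> \<le> p" using assms by (simp add: abs_mult mult_left_le)
  with assms have ps: "\<bar>p * s\<bar> < 1" by linarith
  have "(\<lambda>k. (1 - a) * (1 - p) * s * (p * s) ^ k) sums ((1 - a) * (1 - p) * s * (1 / (1 - p * s)))"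
    by (intro sums_mult geometric_sums) (use ps in simp)
  moreover have "(\<lambda>k. lf_mass a p (Suc k) * s ^ Suc k) = (\<lambda>k. (1 - a) * (1 - p) * s * (p * s) ^ k)"
    by (auto simp: lf_mass_def power_mult_distrib)
  ultimately have "(\<lambda>k. lf_mass a p k * s ^ k) sums
      ((1 - a) * (1 - p) * s * (1 / (1 - p * s)) + lf_mass a p 0 * s ^ 0)"
    by (subst sums_Suc_iff [symmetric]) simp
  moreover have "(1 - a) * (1 - p) * s * (1 / (1 - p * s)) + lf_mass a p 0 * s ^ 0 = lf_gf a p s"
    using ps by (simp add: lf_mass_def lf_gf_def field_simps)
  ultimately show ?thesis by simp
qed

section \<open>Linear fractional maps in the coordinate 1 - s\<close>

text \<open>In the coordinate u = 1 - s the generating functions are Moebius maps u / (A + B u)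
  fixing 0, a family closed under composition. The new coefficients are those by which
  \<open>env_A\<close> and \<open>env_B\<close> grow when one generation is added.\<close>

lemma lf_compose:
  fixes A B m \<eta> u :: real
  assumes "A > 0" "B \<ge> 0" "m > 0" "\<eta> > 0" "u > 0"
  defines "u' \<equiv> u / (1 / m + \<eta> * u)"
  shows "u' / (A + B * u') = u / (A / m + (B + A * \<eta>) * u)"
proof -
  define d where "d = 1 / m + \<eta> * u"
  have d: "d > 0" unfolding d_def using assms by (intro add_pos_pos) auto
  have u': "u' = u / d" by (simp add: u'_def d_def)
  have "A + B * u' = (A * d + B * u) / d" using d by (simp add: u' add_divide_distrib)
  then have "u' / (A + B * u') = u / (A * d + B * u)" using d by (simp add: u')
  also have "A * d + B * u = A / m + (B + A * \<eta>) * u" by (simp add: d_def algebra_simps)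
  finally show ?thesis .
qed

text \<open>For z \<ge> 1, A times this weight is the coefficient of s^z in 1 - (1-s) / (A + B
  (1-s)). The factor A = exp(-S_n) is kept apart because it serves as the unnormalised density of
  the tilt; what remains tends to 1 / B^2 as A tends to 0, for every such z.\<close>

definition lf_weight :: "nat \<Rightarrow> real \<Rightarrow> real \<Rightarrow> real" where
  "lf_weight z A B = B ^ (z - 1) / (A + B) ^ (z + 1)"

text \<open>Apart from z = 0 this is a geometric series of ratio q s with q = B / (A + B).\<close>

lemma lf_expansion:
  fixes A B s :: real
  assumes A: "A > 0" and B: "B \<ge> 0" and s: "\<bar>s\<bar> < 1"
  shows "(\<lambda>z. (if z = 0 then 1 - 1 / (A + B) else A * lf_weight z A B) * s ^ z)
    sums (1 - (1 - s) / (A + B * (1 - s)))"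
proof -
  define q where "q = B / (A + B)"
  have AB: "A + B > 0" using A B by simp
  have q: "0 \<le> q" "q < 1" using A B by (auto simp: q_def divide_less_eq)
  have "\<bar>q * s\<bar> \<le> 1 * \<bar>s\<bar>" unfolding abs_mult using q by (intro mult_right_mono) auto
  then have qs: "\<bar>q * s\<bar> < 1" using s by linarith
  have "(\<lambda>k. A / (A + B)\<^sup>2 * s * (q * s) ^ k) sums (A / (A + B)\<^sup>2 * s * (1 / (1 - q * s)))"
    by (intro sums_mult geometric_sums) (use qs in simp)
  moreover have "A * lf_weight (Suc k) A B * s ^ Suc k = A / (A + B)\<^sup>2 * s * (q * s) ^ k" for k
    using AB by (simp add: lf_weight_def q_def power_mult_distrib power_divide power2_eq_square field_simps)
  ultimately have "(\<lambda>z. (if z = 0 then 1 - 1 / (A + B) else A * lf_weight z A B) * s ^ z)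
      sums (A / (A + B)\<^sup>2 * s * (1 / (1 - q * s)) + (1 - 1 / (A + B)))"
    using sums_Suc_iff[of "\<lambda>z. (if z = 0 then 1 - 1 / (A + B) else A * lf_weight z A B) * s ^ z"]
    by simp
  moreover have "A / (A + B)\<^sup>2 * s * (1 / (1 - q * s)) + (1 - 1 / (A + B)) = 1 - (1 - s) / (A + B * (1 - s))"
  proof -
    define D where "D = A + B * (1 - s)"
    have D: "D > 0" using A B s by (auto simp: D_def intro!: add_pos_nonneg)
    have "1 - q * s = D / (A + B)" using AB by (simp add: q_def D_def field_simps)
    then have "A / (A + B)\<^sup>2 * s * (1 / (1 - q * s)) = A * s / ((A + B) * D)"
      using AB D by (simp add: power2_eq_square)
    moreover have "1 / (A + B) - (1 - s) / D = A * s / ((A + B) * D)"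
      using AB D by (simp add: divide_simps) (simp add: D_def algebra_simps)
    ultimately show ?thesis by (simp only: D_def)
  qed
  ultimately show ?thesis by (simp only:)
qed

text \<open>The coefficients in $1 - F(s) = (1-s)/(A + B(1-s))$ for the generating function \<open>F\<close> of
  generation \<open>n\<close> in the fixed environment \<open>x\<close>.\<close>

definition env_A :: "('x \<Rightarrow> real) \<Rightarrow> (nat \<Rightarrow> 'x) \<Rightarrow> nat \<Rightarrow> real" where
  "env_A \<rho> x n = exp (- (\<Sum>k = 1..n. \<rho> (x k)))"

definition env_B :: "('x \<Rightarrow> real) \<Rightarrow> ('x \<Rightarrow> real) \<Rightarrow> (nat \<Rightarrow> 'x) \<Rightarrow> nat \<Rightarrow> real" where
  "env_B \<rho> \<eta> x n = (\<Sum>k<n. env_A \<rho> x k * \<eta> (x (Suc k)))"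

lemma env_A_pos: "env_A \<rho> x n > 0"
  by (simp add: env_A_def)

lemma env_A_0 [simp]: "env_A \<rho> x 0 = 1"
  by (simp add: env_A_def)

lemma env_A_Suc: "env_A \<rho> x (Suc n) = env_A \<rho> x n * exp (- \<rho> (x (Suc n)))"
  by (simp add: env_A_def exp_add[symmetric])

lemma measurable_random_sum:
  fixes Y :: "'a \<Rightarrow> nat" and V :: "nat \<Rightarrow> 'a \<Rightarrow> nat"
  assumes Y: "Y \<in> measurable N (count_space UNIV)"
    and V: "\<And>l. l \<ge> 1 \<Longrightarrow> V l \<in> measurable N (count_space UNIV)"
  shows "(\<lambda>\<omega>. \<Sum>l = 1..Y \<omega>. V l \<omega>) \<in> measurable N (count_space UNIV)"
proof -
  have "(\<lambda>\<omega>. \<Sum>l = 1..k. V l \<omega>) \<in> measurable N (count_space UNIV)" for k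
  proof (induction k)
    case (Suc k)
    have "(\<lambda>\<omega>. c + V (Suc k) \<omega>) \<in> measurable N (count_space UNIV)" for c
      by (rule measurable_compose[OF V]) auto
    from measurable_compose_countable[OF this Suc] show ?case by simp
  qed simp
  from measurable_compose_countable[OF this Y] show ?thesis by simp
qed

text \<open>\<open>N\<close> and \<open>\<zeta>\<close> are general because three spaces occur: the
  probability space itself, a product space indexed by offspring variables, and the space carrying
  only the sigma-algebra that these variables generate.\<close>

lemma measurable_branching:
  assumes "\<And>m l. 1 \<le> m \<Longrightarrow> m \<le> n \<Longrightarrow> 1 \<le> l \<Longrightarrow> \<zeta> (x m) m l \<in> measurable N (count_space UNIV)"
  shows "branching (\<lambda>k _. x k) \<zeta> n \<in> measurable N (count_space UNIV)"
  using assms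
proof (induction n)
  case 0
  have "branching (\<lambda>k _. x k) \<zeta> 0 = (\<lambda>_. 1)" by auto
  then show ?case by simp
next
  case (Suc n)
  have "branching (\<lambda>k _. x k) \<zeta> (Suc n)
      = (\<lambda>\<omega>. \<Sum>l = 1..branching (\<lambda>k _. x k) \<zeta> n \<omega>. \<zeta> (x (Suc n)) (Suc n) l \<omega>)" by auto
  then show ?case
    by (simp only:) (intro measurable_random_sum Suc.IH Suc.prems; simp)
qed

lemma branching_cong:
  assumes "\<And>k. 1 \<le> k \<Longrightarrow> k \<le> n \<Longrightarrow> X k \<omega> = X' k \<omega>'"
    and "\<And>k l. 1 \<le> k \<Longrightarrow> k \<le> n \<Longrightarrow> 1 \<le> l \<Longrightarrow> \<zeta> (X k \<omega>) k l \<omega> = \<zeta>' (X k \<omega>) k l \<omega>'"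
  shows "branching X \<zeta> n \<omega> = branching X' \<zeta>' n \<omega>'"
  using assms by (induction n) (auto intro!: sum.cong)

section \<open>The generating function in a fixed environment\<close>

context lf_branching_markov_env
begin

abbreviation "\<rho> \<equiv> log_mean a p"

text \<open>For the offspring generating function f of the state x this is f''(1) / (2 f'(1)^2), the
  constant in 1 / (1 - f(s)) = 1 / (m (1-s)) + \<eta> with m = f'(1).\<close>

definition "\<eta> x = p x / (1 - a x)"

lemma \<eta>_pos: "\<eta> x > 0"
  using a_range[of x] p_range[of x] by (simp add: \<eta>_def)

lemma env_B_nonneg: "0 \<le> env_B \<rho> \<eta> x n"
  unfolding env_B_def by (intro sum_nonneg mult_nonneg_nonneg less_imp_le[OF env_A_pos] less_imp_le[OF \<eta>_pos])

lemma exp_log_mean: "exp (- \<rho> x) = (1 - p x) / (1 - a x)"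
proof -
  have "(1 - a x) / (1 - p x) > 0" using a_range[of x] p_range[of x] by simp
  then show ?thesis
    using p_range[of x] by (simp add: log_mean_def lf_mean_eq exp_minus)
qed

lemma lf_gf_eq: "\<bar>s\<bar> \<le> 1 \<Longrightarrow> 1 - lf_gf (a x) (p x) s = (1 - s) / (exp (- \<rho> x) + \<eta> x * (1 - s))"
proof -
  assume s: "\<bar>s\<bar> \<le> 1"
  have "p x * s \<le> p x" using s p_range[of x] by (simp add: mult_left_le)
  then have "1 - p x * s > 0" using p_range[of x] by linarith
  moreover have "exp (- \<rho> x) + \<eta> x * (1 - s) = (1 - p x * s) / (1 - a x)"
    by (simp add: exp_log_mean \<eta>_def add_divide_distrib[symmetric] algebra_simps)
  ultimately show ?thesis using a_range[of x] by (simp only:) (simp add: lf_gf_def)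
qed

lemma \<xi>_measurable:
  "1 \<le> n \<Longrightarrow> 1 \<le> l \<Longrightarrow> \<xi> x n l \<in> measurable (M i) (count_space UNIV)"
proof -
  interpret prob_space "M i" by (rule prob_space_M)
  show "1 \<le> n \<Longrightarrow> 1 \<le> l \<Longrightarrow> ?thesis"
    using \<xi>_indep[of i] by (force simp: indep_vars_def)
qed

lemma offspring_gf:
  assumes "1 \<le> n" "1 \<le> l" "\<bar>s\<bar> \<le> 1"
  shows "(\<integral>\<omega>. s ^ \<xi> x n l \<omega> \<partial>M i) = lf_gf (a x) (p x) s"
proof -
  interpret prob_space "M i" by (rule prob_space_M)
  have "(\<lambda>k. lf_mass (a x) (p x) k * s ^ k) sums (\<integral>\<omega>. s ^ \<xi> x n l \<omega> \<partial>M i)"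
    using generating_function_sums[OF \<xi>_measurable[OF assms(1,2)] assms(3)]
    by (simp add: \<xi>_law[OF assms(1,2)])
  moreover have "(\<lambda>k. lf_mass (a x) (p x) k * s ^ k) sums lf_gf (a x) (p x) s"
    using p_range assms by (intro lf_mass_sums_lf_gf_abs)
  ultimately show ?thesis by (rule sums_unique2)
qed

text \<open>In a fixed environment generation n is a function of the offspring variables with time
  index at most n, and these are disjoint from the variables of time n + 1. Block 0 of
  \<open>K\<close> holds this whole past, block j \<ge> 1 the single variable of individual j; over
  independent blocks the expectation of the product factorises.\<close>

lemma offspring_independent_of_past:
  assumes s: "\<bar>s\<bar> \<le> 1"
  shows "(\<integral>\<omega>. indicator {k} (branching (\<lambda>m _. x m) \<xi> n \<omega>) * s ^ (\<Sum>l = 1..k. \<xi> (x (Suc n)) (Suc n) l \<omega>) \<partial>M i)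
    = \<P>(\<omega> in M i. branching (\<lambda>m _. x m) \<xi> n \<omega> = k) * lf_gf (a (x (Suc n))) (p (x (Suc n))) s ^ k"
proof -
  interpret prob_space "M i" by (rule prob_space_M)
  let ?Z = "branching (\<lambda>m _. x m) \<xi> n"
  let ?x = "x (Suc n)"
  let ?I = "{(x, n, l). 1 \<le> n \<and> 1 \<le> l}"
  define \<zeta> where "\<zeta> = (\<lambda>(x, n, l). \<xi> x n l)"
  define K :: "nat \<Rightarrow> ('x \<times> nat \<times> nat) set" where "K = (\<lambda>j. if j = 0 then {(y, m, l). 1 \<le> m \<and> m \<le> n \<and> 1 \<le> l} else {(?x, Suc n, j)})"
  \<comment> \<open>The past is rebuilt from its block by running \<open>branching\<close> on
    coordinates in place of random variables, which exhibits it as a measurable function on the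
    product space.\<close>
  define F where "F = (\<lambda>j. if j = 0
    then (\<lambda>y. indicat_real {k} (branching (\<lambda>m _. x m) (\<lambda>a b c y. y (a, b, c)) n y))
    else (\<lambda>y. s ^ y (?x, Suc n, j)))"
  have "indep_vars (\<lambda>j. PiM (K j) (\<lambda>_. count_space UNIV)) (\<lambda>j \<omega>. restrict (\<lambda>i. \<zeta> i \<omega>) (K j)) {0..k}"
    by (rule indep_vars_restrict[OF \<xi>_indep[of i, folded \<zeta>_def]])
       (auto simp: K_def \<zeta>_def disjoint_family_on_def split: if_splits)
  moreover have "F j \<in> borel_measurable (PiM (K j) (\<lambda>_. count_space UNIV))" for j
  proof (cases "j = 0")
    case True
    have "branching (\<lambda>m _. x m) (\<lambda>a b c y. y (a, b, c)) n
        \<in> measurable (PiM (K 0) (\<lambda>_. count_space UNIV)) (count_space UNIV)"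
      by (rule measurable_branching, rule measurable_component_singleton) (auto simp: K_def)
    from measurable_compose[OF this, of "indicat_real {k}" borel] show ?thesis
      using True by (simp add: F_def)
  next
    case False
    have "(\<lambda>y. y (?x, Suc n, j)) \<in> measurable (PiM (K j) (\<lambda>_. count_space UNIV)) (count_space (UNIV :: nat set))"
      by (rule measurable_component_singleton) (use False in \<open>auto simp: K_def\<close>)
    from measurable_compose[OF this, of "\<lambda>m. s ^ m" borel] show ?thesis
      using False by (simp add: F_def)
  qed
  ultimately have "indep_vars (\<lambda>_. borel) (\<lambda>j \<omega>. F j (restrict (\<lambda>i. \<zeta> i \<omega>) (K j))) {0..k}"
    by (rule indep_vars_compose2)
  moreover define V where "V = (\<lambda>j \<omega>. F j (restrict (\<lambda>i. \<zeta> i \<omega>) (K j)))"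
  ultimately have V_indep: "indep_vars (\<lambda>_. borel) V {0..k}" by simp
  have V0: "V 0 \<omega> = indicator {k} (?Z \<omega>)" for \<omega>
  proof -
    have "branching (\<lambda>m _. x m) (\<lambda>a b c y. y (a, b, c)) n (restrict (\<lambda>i. \<zeta> i \<omega>) (K 0)) = ?Z \<omega>"
      by (rule branching_cong) (auto simp: K_def \<zeta>_def)
    then show ?thesis by (simp add: V_def F_def)
  qed
  have VS: "V l \<omega> = s ^ \<xi> ?x (Suc n) l \<omega>" if "l \<ge> 1" for l \<omega>
    using that by (auto simp: V_def F_def K_def \<zeta>_def)
  have Vb: "\<bar>V l \<omega>\<bar> \<le> 1" for l \<omega>
    using s by (cases "l \<ge> 1") (auto simp: VS V0 power_abs power_le_one not_le indicator_def)
  have V_int: "integrable (M i) (V l)" if "l \<in> {0..k}" for l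
    using V_indep that Vb by (intro integrable_const_bound[of _ 1]) (auto simp: indep_vars_def)
  have "(\<integral>\<omega>. indicator {k} (?Z \<omega>) * s ^ (\<Sum>l = 1..k. \<xi> ?x (Suc n) l \<omega>) \<partial>M i) = (\<integral>\<omega>. (\<Prod>l\<in>{0..k}. V l \<omega>) \<partial>M i)"
    by (intro Bochner_Integration.integral_cong)
       (auto simp: V0 VS power_sum prod.atLeast_Suc_atMost)
  also have "\<dots> = (\<Prod>l\<in>{0..k}. \<integral>\<omega>. V l \<omega> \<partial>M i)"
    by (rule indep_vars_lebesgue_integral[OF _ V_indep V_int]) auto
  also have "\<dots> = (\<integral>\<omega>. V 0 \<omega> \<partial>M i) * (\<Prod>l = 1..k. \<integral>\<omega>. V l \<omega> \<partial>M i)"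
    by (simp add: prod.atLeast_Suc_atMost)
  also have "(\<Prod>l = 1..k. \<integral>\<omega>. V l \<omega> \<partial>M i) = lf_gf (a ?x) (p ?x) s ^ k"
    using s by (simp add: VS offspring_gf)
  also have "(\<integral>\<omega>. V 0 \<omega> \<partial>M i) = (\<integral>\<omega>. indicator {\<omega> \<in> space (M i). ?Z \<omega> = k} \<omega> \<partial>M i)"
    by (intro Bochner_Integration.integral_cong) (auto simp: V0 indicator_def)
  also have "\<dots> = \<P>(\<omega> in M i. ?Z \<omega> = k)"
    by (simp add: Int_absorb2 subset_eq)
  finally show ?thesis .
qed

text \<open>Conditioning on generation n replaces s by f(s), with f the offspring generating
  function at time n + 1. The newest generation is thus the innermost map and the induction
  hypothesis is applied at f(s); hence s is generalised and |f(s)| \<le> 1 is checked first.\<close>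

lemma branching_gf:
  assumes s: "\<bar>s\<bar> \<le> 1"
  shows "(\<integral>\<omega>. s ^ branching (\<lambda>m _. x m) \<xi> n \<omega> \<partial>M i)
    = 1 - (1 - s) / (env_A \<rho> x n + env_B \<rho> \<eta> x n * (1 - s))"
  using s
proof (induction n arbitrary: s)
  case 0
  interpret prob_space "M i" by (rule prob_space_M)
  show ?case by (simp add: env_B_def prob_space)
next
  case (Suc n)
  interpret prob_space "M i" by (rule prob_space_M)
  let ?Z = "branching (\<lambda>m _. x m) \<xi>"
  let ?x = "x (Suc n)"
  define f where "f = lf_gf (a ?x) (p ?x) s"
  have Z: "?Z m \<in> measurable (M i) (count_space UNIV)" for m
    by (rule measurable_branching[OF \<xi>_measurable])
  have f1: "\<bar>f\<bar> \<le> 1"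
  proof -
    have "f = (\<integral>\<omega>. s ^ \<xi> ?x 1 1 \<omega> \<partial>M i)" unfolding f_def using Suc.prems by (simp add: offspring_gf)
    also have "\<bar>\<dots>\<bar> \<le> (\<integral>\<omega>. \<bar>s ^ \<xi> ?x 1 1 \<omega>\<bar> \<partial>M i)" by (rule integral_abs_bound)
    also have "\<dots> \<le> (\<integral>\<omega>. 1 \<partial>M i)"
      using Suc.prems by (intro integral_mono_AE' AE_I2) (auto simp: power_abs power_le_one)
    finally show ?thesis by (simp add: prob_space)
  qed
  have "(\<lambda>k. \<integral>\<omega>. indicator {k} (?Z n \<omega>) * s ^ (\<Sum>l = 1..k. \<xi> ?x (Suc n) l \<omega>) \<partial>M i)
      sums (\<integral>\<omega>. s ^ (\<Sum>l = 1..?Z n \<omega>. \<xi> ?x (Suc n) l \<omega>) \<partial>M i)"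
  proof (rule expectation_stopped_sums[OF Z])
    fix k
    have "(\<lambda>\<omega>. \<Sum>l = 1..k. \<xi> ?x (Suc n) l \<omega>) \<in> measurable (M i) (count_space UNIV)"
      by (rule measurable_random_sum[OF measurable_const \<xi>_measurable]) auto
    from measurable_compose[OF this, of "\<lambda>m. s ^ m" borel]
    show "(\<lambda>\<omega>. s ^ (\<Sum>l = 1..k. \<xi> ?x (Suc n) l \<omega>)) \<in> borel_measurable (M i)" by simp
  qed (use Suc.prems in \<open>auto simp: power_abs power_le_one\<close>)
  then have "(\<lambda>k. \<P>(\<omega> in M i. ?Z n \<omega> = k) * f ^ k) sums (\<integral>\<omega>. s ^ ?Z (Suc n) \<omega> \<partial>M i)"
    by (simp only: offspring_independent_of_past[OF Suc.prems] f_def branching.simps)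
  moreover have "(\<lambda>k. \<P>(\<omega> in M i. ?Z n \<omega> = k) * f ^ k) sums (\<integral>\<omega>. f ^ ?Z n \<omega> \<partial>M i)"
    by (rule generating_function_sums[OF Z f1])
  ultimately have "(\<integral>\<omega>. s ^ ?Z (Suc n) \<omega> \<partial>M i) = (\<integral>\<omega>. f ^ ?Z n \<omega> \<partial>M i)"
    by (rule sums_unique2)
  also have "\<dots> = 1 - (1 - f) / (env_A \<rho> x n + env_B \<rho> \<eta> x n * (1 - f))"
    by (rule Suc.IH[OF f1])
  also have "(1 - f) / (env_A \<rho> x n + env_B \<rho> \<eta> x n * (1 - f))
      = (1 - s) / (env_A \<rho> x (Suc n) + env_B \<rho> \<eta> x (Suc n) * (1 - s))"
  \<comment> \<open>\<open>lf_compose\<close> asks for 1 - s > 0; at s = 1 both sides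
    vanish.\<close>
  proof (cases "s = 1")
    case True
    then have "f = 1" by (simp add: f_def lf_gf_def)
    with True show ?thesis by simp
  next
    case False
    then have u: "1 - s > 0" using Suc.prems by auto
    have "1 - f = (1 - s) / (1 / exp (\<rho> ?x) + \<eta> ?x * (1 - s))"
      unfolding f_def using lf_gf_eq[OF Suc.prems, of ?x] by (simp add: exp_minus divide_inverse)
    then show ?thesis
      using lf_compose[OF env_A_pos[of \<rho> x n] env_B_nonneg[of x n] exp_gt_zero[of "\<rho> ?x"] \<eta>_pos[of ?x] u]
      by (simp add: env_A_Suc env_B_def exp_minus divide_inverse)
  qed
  finally show ?case .
qed

lemma branching_fixed_env_law:
  assumes "z \<ge> 1"
  shows "\<P>(\<omega> in M i. branching (\<lambda>m _. x m) \<xi> n \<omega> = z)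
    = env_A \<rho> x n * lf_weight z (env_A \<rho> x n) (env_B \<rho> \<eta> x n)"
proof -
  interpret prob_space "M i" by (rule prob_space_M)
  let ?Z = "branching (\<lambda>m _. x m) \<xi> n"
  let ?A = "env_A \<rho> x n" and ?B = "env_B \<rho> \<eta> x n"
  have Z: "?Z \<in> measurable (M i) (count_space UNIV)"
    by (rule measurable_branching[OF \<xi>_measurable])
  have "\<P>(\<omega> in M i. ?Z \<omega> = z) = (if z = 0 then 1 - 1 / (?A + ?B) else ?A * lf_weight z ?A ?B)"
  proof (rule powser_coeffs_unique[of "\<lambda>z. \<P>(\<omega> in M i. ?Z \<omega> = z)"
        "\<lambda>z. if z = 0 then 1 - 1 / (?A + ?B) else ?A * lf_weight z ?A ?B" z])
    fix s :: real assume s: "\<bar>s\<bar> < 1"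
    then have s': "\<bar>s\<bar> \<le> 1" by simp
    show "\<exists>y. (\<lambda>z. \<P>(\<omega> in M i. ?Z \<omega> = z) * s ^ z) sums y \<and>
        (\<lambda>z. (if z = 0 then 1 - 1 / (?A + ?B) else ?A * lf_weight z ?A ?B) * s ^ z) sums y"
      using generating_function_sums[OF Z s', unfolded branching_gf[OF s']]
        lf_expansion[OF env_A_pos[of \<rho> x n] env_B_nonneg[of x n] s] by (intro exI conjI)
  qed
  then show ?thesis using assms by simp
qed

end

section \<open>Expectations along the environment\<close>

context lf_branching_markov_env
begin

lemma path_event: "{\<omega> \<in> space (M i). \<forall>k\<le>n. X k \<omega> = x k} \<in> sets (M i)"
proof -
  have "{\<omega> \<in> space (M i). X k \<omega> = x k} \<in> sets (M i)" for k
    using measurable_sets[OF X_measurable[of k i], of "{x k}"]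
    by (simp add: vimage_def Int_def conj_commute)
  then have "{\<omega> \<in> space (M i). \<forall>k\<in>{..n}. X k \<omega> = x k} \<in> sets (M i)"
    by (intro sets.sets_Collect_finite_All) auto
  then show ?thesis by (simp only: Ball_def atMost_iff)
qed

text \<open>This replaces measurability with respect to X_0, ..., X_n. As the state space is finite,
  such a functional of the chain takes finitely many values and its expectations are finite sums
  over paths.\<close>

definition depends_upto :: "nat \<Rightarrow> ((nat \<Rightarrow> 'x) \<Rightarrow> real) \<Rightarrow> bool" where
  "depends_upto n \<Phi> \<longleftrightarrow> (\<forall>x y. (\<forall>k\<le>n. x k = y k) \<longrightarrow> \<Phi> x = \<Phi> y)"

abbreviation "paths n \<equiv> PiE {..n} (\<lambda>_. UNIV :: 'x set)"

lemma path_decomposition: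
  assumes "depends_upto n \<Phi>" "\<omega> \<in> space (M i)"
  shows "\<Phi> (\<lambda>k. X k \<omega>)
    = (\<Sum>x\<in>paths n. \<Phi> x * indicator {\<omega> \<in> space (M i). \<forall>k\<le>n. X k \<omega> = x k} \<omega>)"
proof -
  \<comment> \<open>Restriction makes the trajectory extensional, hence a member of
    \<open>paths n\<close>; it is the only one that matches.\<close>
  define x0 where "x0 = restrict (\<lambda>k. X k \<omega>) {..n}"
  have x0: "x0 \<in> paths n" by (auto simp: x0_def)
  have iff: "(\<forall>k\<le>n. X k \<omega> = x k) \<longleftrightarrow> x = x0" if "x \<in> paths n" for x
  proof
    assume "\<forall>k\<le>n. X k \<omega> = x k"
    then show "x = x0" by (intro PiE_ext[OF that x0]) (auto simp: x0_def)
  qed (auto simp: x0_def)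
  have "(\<Sum>x\<in>paths n. \<Phi> x * indicator {\<omega> \<in> space (M i). \<forall>k\<le>n. X k \<omega> = x k} \<omega>)
      = (\<Sum>x\<in>paths n. if x = x0 then \<Phi> x else 0)"
    using iff assms(2) by (intro sum.cong) (auto simp: indicator_def)
  also have "\<dots> = \<Phi> x0" using x0 by (simp add: finite_PiE)
  also have "\<dots> = \<Phi> (\<lambda>k. X k \<omega>)"
    using assms(1) unfolding depends_upto_def by (auto simp: x0_def)
  finally show ?thesis ..
qed

lemma path_expectation:
  assumes "depends_upto n \<Phi>" "integrable (M i) G"
  shows "integrable (M i) (\<lambda>\<omega>. \<Phi> (\<lambda>k. X k \<omega>) * G \<omega>)" (is ?int)
    and "(\<integral>\<omega>. \<Phi> (\<lambda>k. X k \<omega>) * G \<omega> \<partial>M i)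
      = (\<Sum>x\<in>paths n. \<Phi> x * (\<integral>\<omega>. indicator {\<omega> \<in> space (M i). \<forall>k\<le>n. X k \<omega> = x k} \<omega> * G \<omega> \<partial>M i))" (is ?eq)
proof -
  let ?E = "\<lambda>x. {\<omega> \<in> space (M i). \<forall>k\<le>n. X k \<omega> = x k}"
  have eq: "\<Phi> (\<lambda>k. X k \<omega>) * G \<omega> = (\<Sum>x\<in>paths n. \<Phi> x * (indicator (?E x) \<omega> * G \<omega>))"
    if "\<omega> \<in> space (M i)" for \<omega>
    unfolding path_decomposition[OF assms(1) that] by (simp add: sum_distrib_right mult.assoc)
  have int: "integrable (M i) (\<lambda>\<omega>. \<Phi> x * (indicator (?E x) \<omega> * G \<omega>))" for x
    using integrable_mult_indicator[OF path_event assms(2)] by (intro integrable_mult_right) simp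
  show ?int
    by (rule iffD2[OF Bochner_Integration.integrable_cong[OF refl eq]]) (auto intro: int)
  have "(\<integral>\<omega>. \<Phi> (\<lambda>k. X k \<omega>) * G \<omega> \<partial>M i)
      = (\<integral>\<omega>. (\<Sum>x\<in>paths n. \<Phi> x * (indicator (?E x) \<omega> * G \<omega>)) \<partial>M i)"
    by (rule Bochner_Integration.integral_cong[OF refl eq])
  also have "\<dots> = (\<Sum>x\<in>paths n. \<Phi> x * (\<integral>\<omega>. indicator (?E x) \<omega> * G \<omega> \<partial>M i))"
    by (subst Bochner_Integration.integral_sum[OF int]) simp
  finally show ?eq .
qed

lemma path_integrable:
  assumes "depends_upto n \<Phi>"
  shows "integrable (M i) (\<lambda>\<omega>. \<Phi> (\<lambda>k. X k \<omega>))"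
proof -
  interpret prob_space "M i" by (rule prob_space_M)
  show ?thesis using path_expectation(1)[OF assms, of i "\<lambda>_. 1"] by simp
qed

text \<open>By the sum over paths it is enough to work on the event of one path. The Markov
  hypothesis concerns paths of positive probability; on the others both sides are 0.\<close>

lemma markov_step:
  assumes \<Phi>: "depends_upto n \<Phi>"
  shows "(\<integral>\<omega>. \<Phi> (\<lambda>k. X k \<omega>) * g (X (Suc n) \<omega>) \<partial>M i) = (\<integral>\<omega>. \<Phi> (\<lambda>k. X k \<omega>) * trans_op P g (X n \<omega>) \<partial>M i)"
proof -
  interpret prob_space "M i" by (rule prob_space_M)
  let ?E = "\<lambda>x. {\<omega> \<in> space (M i). \<forall>k\<le>n. X k \<omega> = x k}"
  have int: "integrable (M i) (\<lambda>\<omega>. h (X m \<omega>))" for h :: "'x \<Rightarrow> real" and m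
  proof (rule path_integrable)
    show "depends_upto m (\<lambda>x. h (x m))" unfolding depends_upto_def by (metis order_refl)
  qed
  have "(\<integral>\<omega>. indicator (?E x) \<omega> * g (X (Suc n) \<omega>) \<partial>M i)
      = (\<integral>\<omega>. indicator (?E x) \<omega> * trans_op P g (X n \<omega>) \<partial>M i)" for x
  proof -
    let ?F = "\<lambda>y. {\<omega> \<in> space (M i). X (Suc n) \<omega> = y \<and> (\<forall>k\<le>n. X k \<omega> = x k)}"
    have F_sets: "?F y \<in> events" for y
    proof -
      have "{\<omega> \<in> space (M i). X (Suc n) \<omega> = y} \<in> events"
        using measurable_sets[OF X_measurable[of "Suc n" i], of "{y}"]
        by (simp add: vimage_def Int_def conj_commute)
      then show ?thesis by (intro sets.sets_Collect_conj path_event)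
    qed
    have F: "prob (?F y) = P (x n) y * prob (?E x)" for y
    proof (cases "prob (?E x) > 0")
      case True
      then show ?thesis using X_markov[OF True, of y] by (simp add: cond_prob_def field_simps)
    next
      case False
      then have E0: "prob (?E x) = 0" using measure_nonneg[of "M i" "?E x"] by linarith
      have "prob (?F y) \<le> prob (?E x)"
        by (rule finite_measure_mono[OF _ path_event]) blast
      then have "prob (?F y) = 0" using E0 measure_nonneg[of "M i" "?F y"] by linarith
      then show ?thesis using E0 by simp
    qed
    have "(\<integral>\<omega>. indicator (?E x) \<omega> * g (X (Suc n) \<omega>) \<partial>M i)
        = (\<integral>\<omega>. (\<Sum>y\<in>UNIV. g y * indicator (?F y) \<omega>) \<partial>M i)"
    proof (rule Bochner_Integration.integral_cong[OF refl])
      fix \<omega> assume "\<omega> \<in> space (M i)"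
      then have "g y * indicator (?F y) \<omega> = (if y = X (Suc n) \<omega> then g y * indicator (?E x) \<omega> else 0)" for y
        by (auto simp: indicator_def)
      then show "indicator (?E x) \<omega> * g (X (Suc n) \<omega>) = (\<Sum>y\<in>UNIV. g y * indicator (?F y) \<omega>)"
        by simp
    qed
    also have "\<dots> = (\<Sum>y\<in>UNIV. g y * prob (?F y))"
    proof -
      have "integrable (M i) (\<lambda>\<omega>. g y * indicator (?F y) \<omega>)" for y
        using F_sets by (intro integrable_mult_right integrable_real_indicator) (auto simp: emeasure_eq_measure)
      then show ?thesis
        by (subst Bochner_Integration.integral_sum) (auto simp: Int_absorb2 subset_eq)
    qed
    also have "\<dots> = trans_op P g (x n) * prob (?E x)"
      unfolding F trans_op_def sum_distrib_right by (simp add: mult_ac)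
    also have "\<dots> = (\<integral>\<omega>. trans_op P g (x n) * indicator (?E x) \<omega> \<partial>M i)"
      by (simp add: Int_absorb2 subset_eq)
    also have "\<dots> = (\<integral>\<omega>. indicator (?E x) \<omega> * trans_op P g (X n \<omega>) \<partial>M i)"
      by (intro Bochner_Integration.integral_cong) (auto simp: indicator_def)
    finally show ?thesis .
  qed
  then show ?thesis by (simp add: path_expectation(2)[OF \<Phi> int])
qed

abbreviation "walk x n \<equiv> (\<Sum>k = 1..n. \<rho> (x k))"

text \<open>The exponential weight sits at the arrival state because the walk sums \<rho> over X_1,
  ..., X_n and leaves out X_0.\<close>

abbreviation "Q t \<equiv> (\<lambda>x y. P x y * exp (t * \<rho> y))"

text \<open>A Feynman-Kac formula: each induction step absorbs the last weight into the terminal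
  function, so g is generalised. The functional \<Phi> carries the past up to an arbitrary time m,
  which allows the tilt to change at that time.\<close>

lemma markov_weighted:
  assumes "depends_upto m \<Phi>"
  shows "(\<integral>\<omega>. \<Phi> (\<lambda>k. X k \<omega>) * exp (t * (\<Sum>l = Suc m..m + k. \<rho> (X l \<omega>))) * g (X (m + k) \<omega>) \<partial>M i)
    = (\<integral>\<omega>. \<Phi> (\<lambda>k. X k \<omega>) * (trans_op (Q t) ^^ k) g (X m \<omega>) \<partial>M i)"
proof (induction k arbitrary: g)
  case (Suc k)
  let ?\<Phi> = "\<lambda>x. \<Phi> x * exp (t * (\<Sum>l = Suc m..m + k. \<rho> (x l)))"
  have "depends_upto (m + k) ?\<Phi>"
    unfolding depends_upto_def
  proof (intro allI impI)
    fix x y assume xy: "\<forall>l\<le>m + k. x l = (y l :: 'x)"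
    then have "\<Phi> x = \<Phi> y" using assms by (simp add: depends_upto_def)
    moreover have "(\<Sum>l = Suc m..m + k. \<rho> (x l)) = (\<Sum>l = Suc m..m + k. \<rho> (y l))"
      using xy by (intro sum.cong) auto
    ultimately show "?\<Phi> x = ?\<Phi> y" by simp
  qed
  from markov_step[OF this, where g = "\<lambda>y. exp (t * \<rho> y) * g y" and i = i]
  have "(\<integral>\<omega>. \<Phi> (\<lambda>k. X k \<omega>) * exp (t * (\<Sum>l = Suc m..m + Suc k. \<rho> (X l \<omega>))) * g (X (m + Suc k) \<omega>) \<partial>M i)
    = (\<integral>\<omega>. \<Phi> (\<lambda>k. X k \<omega>) * exp (t * (\<Sum>l = Suc m..m + k. \<rho> (X l \<omega>)))
        * trans_op P (\<lambda>y. exp (t * \<rho> y) * g y) (X (m + k) \<omega>) \<partial>M i)"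
    by (simp add: distrib_left exp_add mult_ac)
  also have "trans_op P (\<lambda>y. exp (t * \<rho> y) * g y) = trans_op (Q t) g"
    by (simp add: trans_op_def mult_ac fun_eq_iff)
  also have "(\<integral>\<omega>. \<Phi> (\<lambda>k. X k \<omega>) * exp (t * (\<Sum>l = Suc m..m + k. \<rho> (X l \<omega>)))
        * trans_op (Q t) g (X (m + k) \<omega>) \<partial>M i)
      = (\<integral>\<omega>. \<Phi> (\<lambda>k. X k \<omega>) * (trans_op (Q t) ^^ Suc k) g (X m \<omega>) \<partial>M i)"
    by (subst Suc) (simp add: funpow_swap1)
  finally show ?case .
qed simp

lemma expectation_walk:
  "(\<integral>\<omega>. exp (t * walk (\<lambda>k. X k \<omega>) n) * g (X n \<omega>) \<partial>M i) = (trans_op (Q t) ^^ n) g i"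
proof -
  interpret prob_space "M i" by (rule prob_space_M)
  have "depends_upto 0 (\<lambda>_. 1)" by (simp add: depends_upto_def)
  from markov_weighted[OF this, where t = t and k = n and g = g and i = i]
  have "(\<integral>\<omega>. exp (t * walk (\<lambda>k. X k \<omega>) n) * g (X n \<omega>) \<partial>M i)
      = (\<integral>\<omega>. (trans_op (Q t) ^^ n) g (X 0 \<omega>) \<partial>M i)" by simp
  also have "\<dots> = (\<integral>\<omega>. (trans_op (Q t) ^^ n) g i \<partial>M i)"
  proof (rule integral_cong_AE)
    show "(\<lambda>\<omega>. (trans_op (Q t) ^^ n) g (X 0 \<omega>)) \<in> borel_measurable (M i)"
      by (rule measurable_compose[OF X_measurable]) simp
  qed (use X_start[of i] in \<open>auto elim!: eventually_mono\<close>)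
  finally show ?thesis by (simp add: prob_space)
qed

lemma depends_upto_env:
  "depends_upto n (\<lambda>x. F (env_A \<rho> x n) (env_B \<rho> \<eta> x n) (x n))"
  unfolding depends_upto_def
proof (intro allI impI)
  fix x y :: "nat \<Rightarrow> 'x"
  assume "\<forall>k\<le>n. x k = y k"
  then have xy: "x k = y k" if "k \<le> n" for k using that by blast
  have A: "env_A \<rho> x k = env_A \<rho> y k" if "k \<le> n" for k
  proof -
    have "(\<Sum>l = 1..k. \<rho> (x l)) = (\<Sum>l = 1..k. \<rho> (y l))"
      using that by (intro sum.cong refl, subst xy) auto
    then show ?thesis by (simp add: env_A_def)
  qed
  have "env_B \<rho> \<eta> x n = env_B \<rho> \<eta> y n"
    unfolding env_B_def by (intro sum.cong refl, subst A, force, subst xy) auto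
  then show "F (env_A \<rho> x n) (env_B \<rho> \<eta> x n) (x n) = F (env_A \<rho> y n) (env_B \<rho> \<eta> y n) (y n)"
    by (simp only: A[OF order_refl] xy[OF order_refl])
qed

text \<open>On \<open>X = x\<close> the process is the one in the fixed environment \<open>x\<close>, which is independent of \<open>X\<close>.\<close>

lemma branching_state_law:
  assumes z: "z \<ge> 1"
  shows "\<P>(\<omega> in M i. branching X \<xi> n \<omega> = z \<and> X n \<omega> = j)
    = (\<integral>\<omega>. env_A \<rho> (\<lambda>k. X k \<omega>) n
        * lf_weight z (env_A \<rho> (\<lambda>k. X k \<omega>) n) (env_B \<rho> \<eta> (\<lambda>k. X k \<omega>) n)
        * indicator {j} (X n \<omega>) \<partial>M i)"
proof -
  interpret prob_space "M i" by (rule prob_space_M)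
  define E where "E x = {\<omega> \<in> space (M i). \<forall>k\<le>n. X k \<omega> = x k}" for x
  define V where "V x = {\<omega> \<in> space (M i). branching (\<lambda>m _. x m) \<xi> n \<omega> = z}" for x
  let ?W = "{\<omega> \<in> space (M i). branching X \<xi> n \<omega> = z \<and> X n \<omega> = j}"
  have V_eq: "V x = branching (\<lambda>m _. x m) \<xi> n -` {z} \<inter> space (M i)" for x
    by (auto simp: V_def)
  define q where "q = (\<lambda>x. env_A \<rho> x n * lf_weight z (env_A \<rho> x n) (env_B \<rho> \<eta> x n))"
  have V_sets: "V x \<in> events" for x
  proof -
    have "branching (\<lambda>m _. x m) \<xi> n \<in> measurable (M i) (count_space UNIV)"
      by (rule measurable_branching[OF \<xi>_measurable])
    from measurable_sets[OF this, of "{z}"] show ?thesis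
      by (simp add: V_def vimage_def Int_def conj_commute)
  qed
  have indep: "prob (E x \<inter> V x) = prob (E x) * prob (V x)" for x
  proof (rule indep_setD[OF X_\<xi>_indep[of i]])
    let ?GX = "{X n -` B \<inter> space (M i) | n B. True}"
    have basic: "{\<omega> \<in> space (M i). X k \<omega> = x k} \<in> sigma_sets (space (M i)) ?GX" for k
    proof -
      have "{\<omega> \<in> space (M i). X k \<omega> = x k} = X k -` {x k} \<inter> space (M i)" by auto
      then show ?thesis by (intro sigma_sets.Basic) blast
    qed
    interpret SX: sigma_algebra "space (M i)" "sigma_sets (space (M i)) ?GX"
      by (rule sigma_algebra_sigma_sets) auto
    have "{\<omega> \<in> space (M i). \<forall>k\<in>{..n}. X k \<omega> = x k} \<in> sigma_sets (space (M i)) ?GX"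
      by (intro SX.sets_Collect_finite_All basic) auto
    then show "E x \<in> sigma_sets (space (M i)) ?GX" by (simp only: E_def Ball_def atMost_iff)
    let ?G\<xi> = "{\<xi> x n l -` B \<inter> space (M i) | x n l B. 1 \<le> n \<and> 1 \<le> l}"
    \<comment> \<open>\<open>N\<close> carries only the sigma-algebra generated by the offspring
      variables, so that measurability on \<open>N\<close> is the membership required for
      independence from the chain.\<close>
    define N where "N = sigma (space (M i)) ?G\<xi>"
    have G: "?G\<xi> \<subseteq> Pow (space (M i))" by blast
    have N: "space N = space (M i)" "sets N = sigma_sets (space (M i)) ?G\<xi>"
      unfolding N_def by (rule space_measure_of[OF G], rule sets_measure_of[OF G])
    have "\<xi> y m l \<in> measurable N (count_space UNIV)" if "1 \<le> m" "1 \<le> l" for y m l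
    proof (rule measurableI)
      fix B :: "nat set"
      show "\<xi> y m l -` B \<inter> space N \<in> sets N"
        unfolding N using that by (intro sigma_sets.Basic) blast
    qed simp
    then have "branching (\<lambda>m _. x m) \<xi> n \<in> measurable N (count_space UNIV)"
      by (intro measurable_branching) auto
    moreover have "{z} \<in> sets (count_space UNIV)" by simp
    ultimately have "branching (\<lambda>m _. x m) \<xi> n -` {z} \<inter> space N \<in> sets N"
      by (rule measurable_sets)
    then have "branching (\<lambda>m _. x m) \<xi> n -` {z} \<inter> space (M i) \<in> sigma_sets (space (M i)) ?G\<xi>"
      by (simp only: N)
    then show "V x \<in> sigma_sets (space (M i)) ?G\<xi>" by (simp only: V_eq)
  qed
  have dep: "depends_upto n (\<lambda>x. of_bool (x n = j))"
    unfolding depends_upto_def by (metis order_refl)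
  have dep_q: "depends_upto n (\<lambda>x. q x * of_bool (x n = j))"
    unfolding q_def by (rule depends_upto_env)
  have E_sets: "E x \<in> events" for x unfolding E_def by (rule path_event)
  have law: "prob (V x) = q x" for x
    unfolding V_def q_def by (rule branching_fixed_env_law[OF z])
  define G where "G = (\<lambda>\<omega>. indicat_real {z} (branching X \<xi> n \<omega>))"
  have "prob ?W = (\<integral>\<omega>. indicat_real ?W \<omega> \<partial>M i)"
    by (simp add: Int_absorb2 subset_eq)
  also have "\<dots> = (\<integral>\<omega>. (\<Sum>x\<in>paths n. of_bool (x n = j) * indicat_real (E x \<inter> V x) \<omega>) \<partial>M i)"
  proof (rule Bochner_Integration.integral_cong[OF refl])
    fix \<omega> assume \<omega>: "\<omega> \<in> space (M i)"
    have same: "branching X \<xi> n \<omega> = branching (\<lambda>m _. x m) \<xi> n \<omega>" if "\<omega> \<in> E x" for x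
      by (rule branching_cong) (use that in \<open>unfold E_def, blast\<close>, rule refl)
    have "indicat_real ?W \<omega> = of_bool (X n \<omega> = j) * G \<omega>"
      using \<omega> by (auto simp: G_def indicator_def)
    also have "\<dots> = (\<Sum>x\<in>paths n. of_bool (x n = j) * indicat_real (E x) \<omega>) * G \<omega>"
      using path_decomposition[OF dep \<omega>, folded E_def] by simp
    also have "\<dots> = (\<Sum>x\<in>paths n. of_bool (x n = j) * indicat_real (E x \<inter> V x) \<omega>)"
      unfolding sum_distrib_right G_def using \<omega>
      by (intro sum.cong) (auto simp: indicator_def V_def same)
    finally show "indicat_real ?W \<omega> = (\<Sum>x\<in>paths n. of_bool (x n = j) * indicat_real (E x \<inter> V x) \<omega>)" .
  qed
  also have "\<dots> = (\<Sum>x\<in>paths n. of_bool (x n = j) * prob (E x \<inter> V x))"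
  proof -
    have "integrable (M i) (\<lambda>\<omega>. of_bool (x n = j) * indicat_real (E x \<inter> V x) \<omega>)" for x
      using V_sets E_sets
      by (intro integrable_mult_right integrable_real_indicator) (auto simp: emeasure_eq_measure)
    moreover have "E x \<inter> V x \<inter> space (M i) = E x \<inter> V x" for x by (auto simp: V_def)
    ultimately show ?thesis by (subst Bochner_Integration.integral_sum) auto
  qed
  also have "\<dots> = (\<Sum>x\<in>paths n. q x * of_bool (x n = j) * (\<integral>\<omega>. indicat_real (E x) \<omega> * 1 \<partial>M i))"
  proof -
    have "E x \<inter> space (M i) = E x" for x unfolding E_def by blast
    then show ?thesis by (simp add: indep law mult_ac)
  qed
  also have "\<dots> = (\<integral>\<omega>. q (\<lambda>k. X k \<omega>) * of_bool (X n \<omega> = j) * 1 \<partial>M i)"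
    unfolding E_def by (rule path_expectation(2)[OF dep_q, symmetric]) simp
  also have "\<dots> = (\<integral>\<omega>. q (\<lambda>k. X k \<omega>) * indicat_real {j} (X n \<omega>) \<partial>M i)"
    by (intro Bochner_Integration.integral_cong) (auto simp: indicator_def)
  finally show ?thesis by (simp add: q_def)
qed

end

section \<open>Elementary estimates\<close>

text \<open>This trades boundedness for a moment of order \<delta>, the only kind of moment that
  k(-1-\<delta>) < k(-1) controls.\<close>

lemma min_one_le_powr:
  fixes t \<delta> :: real
  assumes "0 \<le> t" "0 < \<delta>" "\<delta> \<le> 1"
  shows "min 1 t \<le> t powr \<delta>"
proof (cases "t \<le> 1")
  case True
  have "t powr 1 \<le> t powr \<delta>"
    using assms True by (intro powr_mono') auto
  then show ?thesis using assms True by simp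
next
  case False
  then show ?thesis using assms ge_one_powr_ge_zero[of t \<delta>] by simp
qed

text \<open>Truncation at 1 is subadditive on non-negative numbers, so
  \<open>min_one_le_powr\<close> can be used term by term.\<close>

lemma min_one_sum_le:
  fixes f :: "'b \<Rightarrow> real"
  assumes "finite S" "\<And>s. s \<in> S \<Longrightarrow> 0 \<le> f s" "0 < \<delta>" "\<delta> \<le> 1"
  shows "min 1 (sum f S) \<le> (\<Sum>s\<in>S. f s powr \<delta>)"
  using assms(1,2)
proof (induction S)
  case (insert s S)
  have "0 \<le> sum f S" using insert.prems by (intro sum_nonneg) auto
  then have "min 1 (f s + sum f S) \<le> min 1 (f s) + min 1 (sum f S)"
    using insert.prems[of s] by auto
  also have "\<dots> \<le> f s powr \<delta> + (\<Sum>s\<in>S. f s powr \<delta>)"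
    using insert min_one_le_powr[OF _ assms(3,4)] by (intro add_mono) auto
  finally show ?case using insert by simp
qed simp

text \<open>With x = B / (A+B) and y = B0 / B the weight is x^(z+1) / B^2. Bernoulli's inequality
  replaces x^(z+1) by 1 and then y^2 accounts for the passage from B to B0. Both 1 - x and 1 - y are
  at most 1, whence the truncations; z enters only through a constant.\<close>

lemma lf_weight_approx:
  fixes A B B0 b :: real
  assumes A: "A > 0" and b: "b > 0" "b \<le> B0" "B0 \<le> B" and z: "z \<ge> 1"
  shows "\<bar>lf_weight z A B - 1 / B0\<^sup>2\<bar>
    \<le> (1 / b\<^sup>2) * (real (z + 1) * min 1 (A / b) + 2 * min 1 ((B - B0) / b))"
proof -
  define x y where "x = B / (A + B)" and "y = B0 / B"
  have pos: "B0 > 0" "B > 0" using b by auto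
  have x: "0 < x" "x < 1" "1 - x = A / (A + B)"
    using A pos by (auto simp: x_def field_simps)
  have y: "0 < y" "y \<le> 1" "1 - y = (B - B0) / B"
    using pos b by (auto simp: y_def field_simps)
  have lw: "lf_weight z A B = x ^ (z + 1) / B\<^sup>2"
  proof -
    obtain k where k: "z = Suc k" using z by (cases z) auto
    show ?thesis using pos by (simp add: k lf_weight_def x_def power_divide power2_eq_square)
  qed
  have inv: "1 / B\<^sup>2 \<le> 1 / b\<^sup>2" "1 / B0\<^sup>2 \<le> 1 / b\<^sup>2"
    using b pos by (auto intro!: divide_left_mono power_mono mult_pos_pos)
  have "1 + real (z + 1) * (x - 1) \<le> (1 + (x - 1)) ^ (z + 1)"
    using x by (intro Bernoulli_inequality) auto
  then have x_pow: "1 - x ^ (z + 1) \<le> real (z + 1) * (1 - x)" by (simp add: algebra_simps)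
  have "1 - x \<le> A / b" unfolding x(3) using A b pos by (intro divide_left_mono) auto
  then have x_min: "1 - x \<le> min 1 (A / b)" using x by simp
  have xx: "1 - x ^ (z + 1) \<le> real (z + 1) * min 1 (A / b)"
    by (rule order_trans[OF x_pow mult_left_mono[OF x_min]]) simp
  have "x ^ (z + 1) \<le> 1" using x by (intro power_le_one) auto
  then have "\<bar>lf_weight z A B - 1 / B\<^sup>2\<bar> = (1 / B\<^sup>2) * (1 - x ^ (z + 1))"
    unfolding lw using pos by (simp add: diff_divide_distrib[symmetric] abs_divide)
  also have "\<dots> \<le> (1 / b\<^sup>2) * (real (z + 1) * min 1 (A / b))"
    using \<open>x ^ (z + 1) \<le> 1\<close> by (intro mult_mono inv(1) xx) auto
  finally have 1: "\<bar>lf_weight z A B - 1 / B\<^sup>2\<bar> \<le> (1 / b\<^sup>2) * (real (z + 1) * min 1 (A / b))" .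
  have "(B - B0) / B \<le> (B - B0) / b" using b pos by (intro divide_left_mono) auto
  then have y_min: "1 - y \<le> min 1 ((B - B0) / b)" using y by simp
  have y2: "1 - y\<^sup>2 = (1 - y) * (1 + y)" by (simp add: power2_eq_square algebra_simps)
  also have "\<dots> \<le> (1 - y) * 2" using y by (intro mult_left_mono) auto
  also have "\<dots> \<le> min 1 ((B - B0) / b) * 2" by (rule mult_right_mono[OF y_min]) simp
  finally have y_le: "1 - y\<^sup>2 \<le> 2 * min 1 ((B - B0) / b)" by (simp only: mult.commute)
  have "0 \<le> 1 - y\<^sup>2" unfolding y2 using y(1,2) by (intro mult_nonneg_nonneg) auto
  have "1 / B\<^sup>2 = y\<^sup>2 / B0\<^sup>2" using pos by (simp add: y_def power_divide)
  then have "\<bar>1 / B\<^sup>2 - 1 / B0\<^sup>2\<bar> = (1 / B0\<^sup>2) * (1 - y\<^sup>2)"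
    using \<open>0 \<le> 1 - y\<^sup>2\<close> by (simp add: diff_divide_distrib[symmetric] abs_divide)
  also have "\<dots> \<le> (1 / b\<^sup>2) * (2 * min 1 ((B - B0) / b))"
    using inv(2) y_le \<open>0 \<le> 1 - y\<^sup>2\<close> by (intro mult_mono) auto
  finally have 2: "\<bar>1 / B\<^sup>2 - 1 / B0\<^sup>2\<bar> \<le> (1 / b\<^sup>2) * (2 * min 1 ((B - B0) / b))" .
  show ?thesis using 1 2 unfolding distrib_left by linarith
qed

text \<open>A lower bound linear in the truncated quantity, so that its expectation can be bounded
  below by fractional moments. It serves to show that the limit is positive.\<close>

lemma inverse_square_lower_bound:
  fixes B C :: real
  assumes "B > 0" "C > 0"
  shows "(1 / C\<^sup>2) * (1 - min 1 (B / C)) \<le> 1 / B\<^sup>2"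
proof (cases "B \<le> C")
  case True
  have "(1 / C\<^sup>2) * (1 - min 1 (B / C)) \<le> 1 / C\<^sup>2"
    using assms by (intro mult_left_le) auto
  also have "\<dots> \<le> 1 / B\<^sup>2"
    using assms True by (intro divide_left_mono power_mono) auto
  finally show ?thesis .
qed (use assms in auto)

lemma geometric_tail_le:
  fixes r :: real
  assumes "0 \<le> r" "r < 1"
  shows "(\<Sum>l = m..n. r ^ l) \<le> r ^ m / (1 - r)"
proof (cases "m \<le> n")
  case True
  have "(1 - r) * (\<Sum>l = m..n. r ^ l) = r ^ m - r ^ Suc n"
    by (rule sum_gp_multiplied[OF True])
  also have "\<dots> \<le> r ^ m" using assms by simp
  finally show ?thesis using assms by (simp add: field_simps)
qed (use assms in auto)

text \<open>The limit of \<open>c\<close> is determined by \<open>D\<close> alone: this is why it will not depend on \<open>z\<close>.\<close>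

lemma approximate_limit:
  fixes c D :: "nat \<Rightarrow> real" and e :: "nat \<Rightarrow> nat \<Rightarrow> real"
  assumes approx: "\<And>m n. 1 \<le> m \<Longrightarrow> m \<le> n \<Longrightarrow> \<bar>c n - e m n\<bar> \<le> K * r ^ m"
    and e: "\<And>m. 1 \<le> m \<Longrightarrow> (\<lambda>n. e m n) \<longlonglongrightarrow> D m"
    and r: "0 \<le> r" "r < 1"
  shows "convergent D" "c \<longlonglongrightarrow> lim D"
proof -
  have small: "eventually (\<lambda>m. K * r ^ m < \<epsilon>) sequentially" if "\<epsilon> > 0" for \<epsilon>
  proof -
    have "(\<lambda>m. K * r ^ m) \<longlonglongrightarrow> K * 0" using r by (intro tendsto_intros LIMSEQ_realpow_zero)
    then show ?thesis using that by (auto dest: order_tendstoD)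
  qed
  have near: "eventually (\<lambda>n. \<bar>c n - D m\<bar> < K * r ^ m + \<epsilon>) sequentially" if "1 \<le> m" "\<epsilon> > 0" for m \<epsilon>
  proof -
    have "eventually (\<lambda>n. \<bar>e m n - D m\<bar> < \<epsilon>) sequentially"
      using tendstoD[OF e[OF that(1)] that(2)] by (simp add: dist_real_def)
    then show ?thesis using eventually_ge_at_top[of m]
    proof eventually_elim
      case (elim n)
      then show ?case using approx[OF that(1), of n] by linarith
    qed
  qed
  \<comment> \<open>Convergence of \<open>D\<close> is a conclusion, so it cannot be used here: two
    late terms of \<open>c\<close> are compared through one fixed \<open>D m\<close>.\<close>
  have "Cauchy c"
  proof (rule metric_CauchyI)
    fix \<epsilon> :: real assume \<epsilon>: "\<epsilon> > 0"
    have "eventually (\<lambda>m. 1 \<le> m \<and> K * r ^ m < \<epsilon> / 4) sequentially"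
      by (intro eventually_conj eventually_ge_at_top small) (use \<epsilon> in simp)
    then obtain m where m: "1 \<le> m" "K * r ^ m < \<epsilon> / 4"
      by (auto dest: eventually_happens)
    obtain N where N: "\<And>n. n \<ge> N \<Longrightarrow> \<bar>c n - D m\<bar> < K * r ^ m + \<epsilon> / 4"
      using near[OF m(1), of "\<epsilon> / 4"] \<epsilon> by (auto simp: eventually_sequentially)
    show "\<exists>M. \<forall>n\<ge>M. \<forall>k\<ge>M. dist (c n) (c k) < \<epsilon>"
    proof (intro exI allI impI)
      fix n k assume "n \<ge> N" "k \<ge> N"
      then show "dist (c n) (c k) < \<epsilon>" using N[of n] N[of k] m(2) by (simp add: dist_real_def)
    qed
  qed
  then obtain L where L: "c \<longlonglongrightarrow> L" by (auto simp: Cauchy_convergent_iff convergent_def)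
  have D_near: "\<bar>L - D m\<bar> \<le> K * r ^ m" if "1 \<le> m" for m
  proof (rule field_le_epsilon)
    fix \<epsilon> :: real assume "\<epsilon> > 0"
    show "\<bar>L - D m\<bar> \<le> K * r ^ m + \<epsilon>"
    proof (rule tendsto_upperbound)
      show "(\<lambda>n. \<bar>c n - D m\<bar>) \<longlonglongrightarrow> \<bar>L - D m\<bar>" by (intro tendsto_intros L)
      show "eventually (\<lambda>n. \<bar>c n - D m\<bar> \<le> K * r ^ m + \<epsilon>) sequentially"
        using near[OF that \<open>\<epsilon> > 0\<close>] by (rule eventually_mono) simp
    qed simp
  qed
  have "D \<longlonglongrightarrow> L"
  proof (rule tendstoI)
    fix \<epsilon> :: real assume "\<epsilon> > 0"
    show "eventually (\<lambda>m. dist (D m) L < \<epsilon>) sequentially"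
      using small[OF \<open>\<epsilon> > 0\<close>] eventually_ge_at_top[of 1]
    proof eventually_elim
      case (elim m)
      then show ?case using D_near[of m] by (simp add: dist_real_def)
    qed
  qed
  then show "convergent D" "c \<longlonglongrightarrow> lim D" using L by (auto simp: convergent_def limI)
qed

section \<open>The asymptotics of the branching process\<close>

context lf_branching_markov_env
begin

lemma depends_uptoI:
  "(\<And>x y. (\<And>k. k \<le> n \<Longrightarrow> x k = y k) \<Longrightarrow> \<Phi> x = \<Phi> y) \<Longrightarrow> depends_upto n \<Phi>"
  unfolding depends_upto_def by blast

lemma depends_uptoD:
  "depends_upto n \<Phi> \<Longrightarrow> (\<And>k. k \<le> n \<Longrightarrow> x k = y k) \<Longrightarrow> \<Phi> x = \<Phi> y"
  unfolding depends_upto_def by blast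

lemma depends_upto_const: "depends_upto n (\<lambda>_. c)"
  by (rule depends_uptoI) (rule refl)

lemma depends_upto_state: "depends_upto n (\<lambda>x. h (x n))"
  by (rule depends_uptoI, rule arg_cong[where f = h], blast)

lemma depends_upto_mono:
  assumes "depends_upto m \<Phi>" "m \<le> n"
  shows "depends_upto n \<Phi>"
  by (rule depends_uptoI, rule depends_uptoD[OF assms(1)]) (use assms(2) order_trans in blast)

lemma depends_upto_A: "l \<le> n \<Longrightarrow> depends_upto n (\<lambda>x. env_A \<rho> x l)"
  by (rule depends_upto_mono[OF depends_upto_env[of l "\<lambda>A B y. A"]])

lemma depends_upto_B: "l \<le> n \<Longrightarrow> depends_upto n (\<lambda>x. env_B \<rho> \<eta> x l)"
  by (rule depends_upto_mono[OF depends_upto_env[of l "\<lambda>A B y. B"]])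

lemma depends_upto_map2:
  assumes "depends_upto n \<Phi>" "depends_upto n \<Psi>"
  shows "depends_upto n (\<lambda>x. h (\<Phi> x) (\<Psi> x))"
  by (rule depends_uptoI) (intro arg_cong2[where f = h] depends_uptoD[OF assms(1)]
      depends_uptoD[OF assms(2)])

lemma depends_upto_power:
  assumes "depends_upto n \<Phi>"
  shows "depends_upto n (\<lambda>x. \<Phi> x ^ k)"
  by (rule depends_uptoI) (intro arg_cong[where f = "\<lambda>a. a ^ k"] depends_uptoD[OF assms])

lemma depends_upto_sum:
  assumes "\<And>l. l \<in> S \<Longrightarrow> depends_upto n (\<Phi> l)"
  shows "depends_upto n (\<lambda>x. \<Sum>l\<in>S. \<Phi> l x)"
  by (rule depends_uptoI) (intro sum.cong refl depends_uptoD[OF assms])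

lemmas depends_upto_intros = depends_upto_const depends_upto_state depends_upto_A depends_upto_B
  depends_upto_sum depends_upto_power depends_upto_map2[where h = "(*)"]
  depends_upto_map2[where h = "(-)"] depends_upto_map2[where h = "(/)"]
  depends_upto_map2[where h = "(powr)"]

section \<open>Estimates of A and B along a path\<close>

lemma env_A_split:
  assumes "l \<le> n"
  shows "env_A \<rho> x n = env_A \<rho> x l * exp (-1 * (\<Sum>k = Suc l..n. \<rho> (x k)))"
proof -
  have "(\<Sum>k = 1..n. \<rho> (x k)) = (\<Sum>k = 1..l. \<rho> (x k)) + (\<Sum>k = Suc l..n. \<rho> (x k))"
    using assms sum.ub_add_nat[of 1 l "\<lambda>k. \<rho> (x k)" "n - l"] by simp
  then show ?thesis by (simp add: env_A_def exp_add[symmetric])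
qed

definition "\<eta>_min = Min (range \<eta>)"
definition "\<eta>_max = Max (range \<eta>)"

lemma \<eta>_bounds: "0 < \<eta>_min" "\<eta>_min \<le> \<eta> x" "\<eta> x \<le> \<eta>_max" "0 < \<eta>_max"
proof -
  show 1: "0 < \<eta>_min" unfolding \<eta>_min_def by (subst Min_gr_iff) (auto simp: \<eta>_pos)
  show 2: "\<eta>_min \<le> \<eta> y" "\<eta> y \<le> \<eta>_max" for y
    unfolding \<eta>_min_def \<eta>_max_def by auto
  show "0 < \<eta>_max" using 1 2[of undefined] by linarith
qed

text \<open>The summand k = 0 already contributes \<eta> at the first state, as A_0 = 1. The sum is
  empty for n = 0, which is why later estimates start at m = 1.\<close>

lemma env_B_ge: "1 \<le> n \<Longrightarrow> \<eta>_min \<le> env_B \<rho> \<eta> x n"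
proof -
  assume "1 \<le> n"
  then have "env_A \<rho> x 0 * \<eta> (x (Suc 0)) \<le> env_B \<rho> \<eta> x n"
    unfolding env_B_def
    by (intro member_le_sum[of 0 _ "\<lambda>k. env_A \<rho> x k * \<eta> (x (Suc k))"])
       (auto intro!: mult_nonneg_nonneg less_imp_le[OF env_A_pos] less_imp_le[OF \<eta>_pos])
  then show ?thesis using \<eta>_bounds(2)[of "x (Suc 0)"] by simp
qed

lemma env_B_diff:
  "m \<le> n \<Longrightarrow> env_B \<rho> \<eta> x n - env_B \<rho> \<eta> x m = (\<Sum>k = m..<n. env_A \<rho> x k * \<eta> (x (Suc k)))"
  unfolding env_B_def lessThan_atLeast0
  using sum.atLeastLessThan_concat[of 0 m n "\<lambda>k. env_A \<rho> x k * \<eta> (x (Suc k))"] by simp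

text \<open>The level c is left free: \<open>\<eta>_min\<close> gives the approximation error, while
  a level adapted to the start state gives the lower bound for the limit.\<close>

lemma min_one_env_B_le:
  assumes "0 < \<delta>" "\<delta> \<le> 1" "c > 0" "m \<le> n"
  shows "min 1 ((env_B \<rho> \<eta> x n - env_B \<rho> \<eta> x m) / c)
    \<le> (\<eta>_max / c) powr \<delta> * (\<Sum>k = m..<n. env_A \<rho> x k powr \<delta>)"
proof -
  have "min 1 ((env_B \<rho> \<eta> x n - env_B \<rho> \<eta> x m) / c)
      = min 1 (\<Sum>k = m..<n. env_A \<rho> x k * \<eta> (x (Suc k)) / c)"
    by (simp add: env_B_diff[OF assms(4)] sum_divide_distrib)
  also have "\<dots> \<le> (\<Sum>k = m..<n. (env_A \<rho> x k * \<eta> (x (Suc k)) / c) powr \<delta>)"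
    using assms
    by (intro min_one_sum_le divide_nonneg_nonneg mult_nonneg_nonneg less_imp_le[OF env_A_pos]
        less_imp_le[OF \<eta>_pos]) auto
  also have "\<dots> \<le> (\<Sum>k = m..<n. (\<eta>_max / c) powr \<delta> * env_A \<rho> x k powr \<delta>)"
  proof (rule sum_mono)
    fix k
    have "env_A \<rho> x k * \<eta> (x (Suc k)) / c \<le> \<eta>_max / c * env_A \<rho> x k"
      using \<eta>_bounds(3)[of "x (Suc k)"] env_A_pos[of \<rho> x k] assms(3)
      by (simp add: divide_right_mono mult.commute)
    then have "(env_A \<rho> x k * \<eta> (x (Suc k)) / c) powr \<delta> \<le> (\<eta>_max / c * env_A \<rho> x k) powr \<delta>"
      using assms
      by (intro powr_mono2 divide_nonneg_nonneg mult_nonneg_nonneg less_imp_le[OF env_A_pos]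
          less_imp_le[OF \<eta>_pos]) auto
    also have "\<dots> = (\<eta>_max / c) powr \<delta> * env_A \<rho> x k powr \<delta>"
      by (rule powr_mult)
    finally show "(env_A \<rho> x k * \<eta> (x (Suc k)) / c) powr \<delta> \<le> (\<eta>_max / c) powr \<delta> * env_A \<rho> x k powr \<delta>" .
  qed
  finally show ?thesis by (simp add: sum_distrib_left)
qed

text \<open>The indices m, ..., n-1 pay for freezing B at time m, and the index n for dropping A_n
  from the weight. K is uniform in the path, m and n.\<close>

lemma lf_weight_env_approx:
  assumes \<delta>: "0 < \<delta>" "\<delta> \<le> 1" and z: "1 \<le> z"
  obtains K where "K \<ge> 0" and "\<And>x m n. 1 \<le> m \<Longrightarrow> m \<le> n \<Longrightarrow>
    \<bar>lf_weight z (env_A \<rho> x n) (env_B \<rho> \<eta> x n) - 1 / (env_B \<rho> \<eta> x m)\<^sup>2\<bar>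
      \<le> K * (\<Sum>l = m..n. env_A \<rho> x l powr \<delta>)"
proof -
  let ?b = "\<eta>_min"
  define K1 where "K1 = real (z + 1) * (1 / ?b) powr \<delta>"
  define K2 where "K2 = 2 * (\<eta>_max / ?b) powr \<delta>"
  define K where "K = (1 / ?b\<^sup>2) * (K1 + K2)"
  have K12: "0 \<le> K1" "0 \<le> K2" by (auto simp: K1_def K2_def)
  have "\<bar>lf_weight z (env_A \<rho> x n) (env_B \<rho> \<eta> x n) - 1 / (env_B \<rho> \<eta> x m)\<^sup>2\<bar>
      \<le> K * (\<Sum>l = m..n. env_A \<rho> x l powr \<delta>)" if mn: "1 \<le> m" "m \<le> n" for x m n
  proof -
    let ?A = "env_A \<rho> x" and ?B = "env_B \<rho> \<eta> x"
    let ?S = "\<Sum>l = m..n. ?A l powr \<delta>"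
    have "0 \<le> ?B n - ?B m"
      unfolding env_B_diff[OF mn(2)]
      by (intro sum_nonneg mult_nonneg_nonneg less_imp_le[OF env_A_pos] less_imp_le[OF \<eta>_pos])
    then have "\<bar>lf_weight z (?A n) (?B n) - 1 / (?B m)\<^sup>2\<bar>
        \<le> (1 / ?b\<^sup>2) * (real (z + 1) * min 1 (?A n / ?b) + 2 * min 1 ((?B n - ?B m) / ?b))"
      using mn z by (intro lf_weight_approx env_A_pos \<eta>_bounds env_B_ge) auto
    also have "\<dots> \<le> (1 / ?b\<^sup>2) * (K1 * ?S + K2 * ?S)"
    proof (intro mult_left_mono add_mono)
      have "min 1 (?A n / ?b) \<le> (?A n / ?b) powr \<delta>"
        using \<delta> env_A_pos[of \<rho> x n] \<eta>_bounds(1) by (intro min_one_le_powr) auto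
      also have "\<dots> = (1 / ?b) powr \<delta> * ?A n powr \<delta>"
        using powr_mult[of "1 / ?b" "?A n" \<delta>] env_A_pos[of \<rho> x n] \<eta>_bounds(1) by simp
      also have "\<dots> \<le> (1 / ?b) powr \<delta> * ?S"
        using mn by (intro mult_left_mono member_le_sum[of n _ "\<lambda>l. ?A l powr \<delta>"]) auto
      finally show "real (z + 1) * min 1 (?A n / ?b) \<le> K1 * ?S"
        unfolding K1_def mult.assoc by (intro mult_left_mono) auto
      have "min 1 ((?B n - ?B m) / ?b) \<le> (\<eta>_max / ?b) powr \<delta> * (\<Sum>k = m..<n. ?A k powr \<delta>)"
        by (rule min_one_env_B_le[OF \<delta> \<eta>_bounds(1) mn(2)])
      also have "\<dots> \<le> (\<eta>_max / ?b) powr \<delta> * ?S"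
        by (intro mult_left_mono sum_mono2) auto
      finally show "2 * min 1 ((?B n - ?B m) / ?b) \<le> K2 * ?S"
        unfolding K2_def mult.assoc by (intro mult_left_mono) auto
    qed simp
    also have "\<dots> = K * ?S" by (simp add: K_def distrib_right distrib_left)
    finally show ?thesis .
  qed
  moreover have "K \<ge> 0" using K12 by (simp add: K_def)
  ultimately show ?thesis using that by blast
qed

lemma expectation_state_split:
  assumes "depends_upto m \<Phi>"
  shows "(\<integral>\<omega>. \<Phi> (\<lambda>k. X k \<omega>) * h (X m \<omega>) \<partial>M i)
    = (\<Sum>y\<in>UNIV. (\<integral>\<omega>. \<Phi> (\<lambda>k. X k \<omega>) * indicator {y} (X m \<omega>) \<partial>M i) * h y)"
proof -
  have int: "integrable (M i) (\<lambda>\<omega>. \<Phi> (\<lambda>k. X k \<omega>) * indicat_real {y} (X m \<omega>) * h y)" for y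
    by (rule path_integrable[of m "\<lambda>x. \<Phi> x * indicat_real {y} (x m) * h y"])
       (intro depends_upto_intros assms)
  have "(\<integral>\<omega>. \<Phi> (\<lambda>k. X k \<omega>) * h (X m \<omega>) \<partial>M i)
      = (\<integral>\<omega>. (\<Sum>y\<in>UNIV. \<Phi> (\<lambda>k. X k \<omega>) * indicat_real {y} (X m \<omega>) * h y) \<partial>M i)"
    by (simp add: mult.assoc sum_distrib_left[symmetric] indicator_def)
  also have "\<dots> = (\<Sum>y\<in>UNIV. (\<integral>\<omega>. \<Phi> (\<lambda>k. X k \<omega>) * indicat_real {y} (X m \<omega>) \<partial>M i) * h y)"
    by (subst Bochner_Integration.integral_sum[OF int]) simp
  finally show ?thesis .
qed

section \<open>Moments under the tilt and the limit of the normalised probabilities\<close>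

text \<open>Up to time l the integrand is exp((-1-\<delta>) S_l), afterwards only exp(-(S_n - S_l)).
  The Markov property at time l gives one Perron bound for each stretch, and their product is
  geometric in l once \<open>\<kappa> (-1) ^ n\<close> is factored out.\<close>

lemma tilted_moment_bound:
  assumes prim: "primitive_env P"
    and \<kappa>: "\<And>t. \<kappa> t > 0" and v: "\<And>t x. v t x > 0"
    and eig: "\<And>t x. trans_op (Q t) (v t) x = \<kappa> t * v t x"
  obtains C where "C > 0" and "\<And>i l n. l \<le> n \<Longrightarrow>
    (\<integral>\<omega>. env_A \<rho> (\<lambda>k. X k \<omega>) n * env_A \<rho> (\<lambda>k. X k \<omega>) l powr \<delta> \<partial>M i)
      \<le> C * \<kappa> (-1) ^ n * (\<kappa> (-1 - \<delta>) / \<kappa> (-1)) ^ l"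
proof -
  have Q_nonneg: "0 \<le> Q t x y" for t x y using P_nonneg by simp
  obtain C1 where C1: "C1 > 0" "\<And>n i. (trans_op (Q (-1)) ^^ n) (\<lambda>_. 1) i \<le> C1 * \<kappa> (-1) ^ n"
    by (rule perron_power_upper[OF Q_nonneg \<kappa>[of "-1"] v eig]) blast
  obtain C2 where C2: "C2 > 0" "\<And>n i. (trans_op (Q (-1 - \<delta>)) ^^ n) (\<lambda>_. 1) i \<le> C2 * \<kappa> (-1 - \<delta>) ^ n"
    by (rule perron_power_upper[OF Q_nonneg \<kappa>[of "-1 - \<delta>"] v eig]) blast
  have "(\<integral>\<omega>. env_A \<rho> (\<lambda>k. X k \<omega>) n * env_A \<rho> (\<lambda>k. X k \<omega>) l powr \<delta> \<partial>M i)
      \<le> (C1 * C2) * \<kappa> (-1) ^ n * (\<kappa> (-1 - \<delta>) / \<kappa> (-1)) ^ l" if ln: "l \<le> n" for i l n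
  proof -
    let ?\<Phi> = "\<lambda>x. env_A \<rho> x l * env_A \<rho> x l powr \<delta>"
    have dep: "depends_upto l ?\<Phi>" by (intro depends_upto_intros) auto
    have pow: "?\<Phi> x = exp ((-1 - \<delta>) * walk x l)" for x
      by (simp add: env_A_def powr_def exp_add[symmetric] algebra_simps)
    have "(\<integral>\<omega>. env_A \<rho> (\<lambda>k. X k \<omega>) n * env_A \<rho> (\<lambda>k. X k \<omega>) l powr \<delta> \<partial>M i)
        = (\<integral>\<omega>. ?\<Phi> (\<lambda>k. X k \<omega>) * exp (-1 * (\<Sum>k = Suc l..l + (n - l). \<rho> (X k \<omega>))) * 1 \<partial>M i)"
      using ln by (simp add: env_A_split[OF ln] mult_ac)
    also have "\<dots> = (\<integral>\<omega>. ?\<Phi> (\<lambda>k. X k \<omega>) * (trans_op (Q (-1)) ^^ (n - l)) (\<lambda>_. 1) (X l \<omega>) \<partial>M i)"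
      by (rule markov_weighted[OF dep, where g = "\<lambda>_. 1"])
    also have "\<dots> \<le> (\<integral>\<omega>. ?\<Phi> (\<lambda>k. X k \<omega>) * (C1 * \<kappa> (-1) ^ (n - l)) \<partial>M i)"
    proof (rule integral_mono)
      show "integrable (M i) (\<lambda>\<omega>. ?\<Phi> (\<lambda>k. X k \<omega>) * (trans_op (Q (-1)) ^^ (n - l)) (\<lambda>_. 1) (X l \<omega>))"
        by (rule path_integrable[of l "\<lambda>x. ?\<Phi> x * (trans_op (Q (-1)) ^^ (n - l)) (\<lambda>_. 1) (x l)"])
          (intro depends_upto_intros order_refl)
      show "integrable (M i) (\<lambda>\<omega>. ?\<Phi> (\<lambda>k. X k \<omega>) * (C1 * \<kappa> (-1) ^ (n - l)))"
        by (rule path_integrable[of l "\<lambda>x. ?\<Phi> x * (C1 * \<kappa> (-1) ^ (n - l))"])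
          (intro depends_upto_intros order_refl)
    qed (intro mult_left_mono C1(2) mult_nonneg_nonneg less_imp_le[OF env_A_pos] powr_ge_zero)
    also have "\<dots> = (trans_op (Q (-1 - \<delta>)) ^^ l) (\<lambda>_. 1) i * (C1 * \<kappa> (-1) ^ (n - l))"
      using expectation_walk[where t = "-1 - \<delta>" and n = l and g = "\<lambda>_. 1" and i = i]
      by (simp add: pow)
    also have "\<dots> \<le> (C2 * \<kappa> (-1 - \<delta>) ^ l) * (C1 * \<kappa> (-1) ^ (n - l))"
      using C1(1) \<kappa>[of "-1"] by (intro mult_right_mono C2(2)) auto
    also have "\<dots> = (C1 * C2) * \<kappa> (-1) ^ n * (\<kappa> (-1 - \<delta>) / \<kappa> (-1)) ^ l"
      using \<kappa>[of "-1"] ln by (simp add: power_divide power_diff)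
    finally show ?thesis .
  qed
  then show ?thesis using that[of "C1 * C2"] C1(1) C2(1) by simp
qed

text \<open>The limit is u(i,j) = w(j) times the limit of \<open>J i m\<close>, where
  \<open>J i m\<close> is v(i) times the expectation of 1 / B_m^2 for the chain tilted by the Perron
  eigenvector v, written as an expectation under \<open>M i\<close>.\<close>

lemma branching_state_limit:
  assumes prim: "primitive_env P"
    and \<kappa>: "\<And>t. \<kappa> t > 0" and v: "\<And>t x. v t x > 0"
    and eig: "\<And>t x. trans_op (Q t) (v t) x = \<kappa> t * v t x"
    and \<delta>: "0 < \<delta>" "\<delta> \<le> 1" and less: "\<kappa> (-1 - \<delta>) < \<kappa> (-1)"
  shows "\<exists>u. (\<forall>i j. u i j > 0) \<and> (\<forall>i j. \<forall>z\<ge>1.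
    (\<lambda>n. \<P>(\<omega> in M i. branching X \<xi> n \<omega> = z \<and> X n \<omega> = j) / \<kappa> (-1) ^ n) \<longlonglongrightarrow> u i j)"
proof -
  let ?k = "\<kappa> (-1)" and ?v = "v (-1)"
  let ?A = "\<lambda>n \<omega>. env_A \<rho> (\<lambda>k. X k \<omega>) n" and ?B = "\<lambda>n \<omega>. env_B \<rho> \<eta> (\<lambda>k. X k \<omega>) n"
  define r where "r = \<kappa> (-1 - \<delta>) / ?k"
  have r: "0 \<le> r" "r < 1" using less \<kappa>[of "-1"] \<kappa>[of "-1 - \<delta>"] by (auto simp: r_def)
  have Q_nonneg: "0 \<le> Q t x y" for t x y using P_nonneg by simp
  have Q_prim: "primitive_env (Q t)" for t
    by (rule primitive_env_scale_entries[OF P_nonneg prim]) simp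
  obtain C where C: "C > 0"
    and moment: "\<And>i l n. l \<le> n \<Longrightarrow> (\<integral>\<omega>. ?A n \<omega> * ?A l \<omega> powr \<delta> \<partial>M i) \<le> C * ?k ^ n * r ^ l"
    unfolding r_def by (rule tilted_moment_bound[OF prim \<kappa> v eig]) blast
  obtain w where w: "\<And>j. w j > 0"
    and lim: "\<And>g i. (\<lambda>n. (trans_op (Q (-1)) ^^ n) g i / ?k ^ n) \<longlonglongrightarrow> ?v i * (\<Sum>j\<in>UNIV. w j * g j)"
    by (rule primitive_power_asymptotics[OF Q_nonneg Q_prim \<kappa> v eig]) blast
  define J where "J = (\<lambda>i m. (\<integral>\<omega>. ?A m \<omega> * (1 / (?B m \<omega>)\<^sup>2) * ?v (X m \<omega>) \<partial>M i) / ?k ^ m)"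
  define e where "e = (\<lambda>i j m n. (\<integral>\<omega>. ?A n \<omega> * (1 / (?B m \<omega>)\<^sup>2) * indicat_real {j} (X n \<omega>) \<partial>M i) / ?k ^ n)"
  \<comment> \<open>With B frozen at time m, the Markov property leaves a power of
    \<open>Q (-1)\<close> from m to n applied to the indicator of j; its limit separates the state
    at time m from j.\<close>
  have e_lim: "(\<lambda>n. e i j m n) \<longlonglongrightarrow> J i m * w j" for i j m
  proof (rule LIMSEQ_offset)
    let ?\<Phi> = "\<lambda>x. env_A \<rho> x m * (1 / (env_B \<rho> \<eta> x m)\<^sup>2)"
    let ?c = "\<lambda>y. \<integral>\<omega>. ?\<Phi> (\<lambda>k. X k \<omega>) * indicator {y} (X m \<omega>) \<partial>M i"
    have dep: "depends_upto m ?\<Phi>" by (rule depends_upto_env[of m "\<lambda>A B y. A * (1 / B\<^sup>2)"])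
    have "e i j m (q + m) = (\<Sum>y\<in>UNIV. ?c y * ((trans_op (Q (-1)) ^^ q) (indicat_real {j}) y / ?k ^ q)) / ?k ^ m" for q
    proof -
      have "(\<integral>\<omega>. ?A (q + m) \<omega> * (1 / (?B m \<omega>)\<^sup>2) * indicat_real {j} (X (q + m) \<omega>) \<partial>M i)
          = (\<integral>\<omega>. ?\<Phi> (\<lambda>k. X k \<omega>) * exp (-1 * (\<Sum>k = Suc m..m + q. \<rho> (X k \<omega>))) * indicat_real {j} (X (m + q) \<omega>) \<partial>M i)"
        by (simp add: env_A_split[of m "q + m"] add.commute[of m] mult_ac)
      also have "\<dots> = (\<integral>\<omega>. ?\<Phi> (\<lambda>k. X k \<omega>) * (trans_op (Q (-1)) ^^ q) (indicat_real {j}) (X m \<omega>) \<partial>M i)"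
        by (rule markov_weighted[OF dep])
      also have "\<dots> = (\<Sum>y\<in>UNIV. ?c y * (trans_op (Q (-1)) ^^ q) (indicat_real {j}) y)"
        by (rule expectation_state_split[OF dep])
      finally show ?thesis by (simp add: e_def power_add sum_divide_distrib)
    qed
    moreover have "(\<lambda>q. (\<Sum>y\<in>UNIV. ?c y * ((trans_op (Q (-1)) ^^ q) (indicat_real {j}) y / ?k ^ q)) / ?k ^ m)
        \<longlonglongrightarrow> (\<Sum>y\<in>UNIV. ?c y * (?v y * (\<Sum>j'\<in>UNIV. w j' * indicat_real {j} j'))) / ?k ^ m"
      by (intro tendsto_divide tendsto_sum tendsto_mult tendsto_const lim)
         (use \<kappa>[of "-1"] in simp)
    moreover have "(\<Sum>y\<in>UNIV. ?c y * (?v y * (\<Sum>j'\<in>UNIV. w j' * indicat_real {j} j'))) / ?k ^ m = J i m * w j"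
    proof -
      have "(\<Sum>j'\<in>UNIV. w j' * indicat_real {j} j') = w j"
        by (simp add: indicator_def if_distrib cong: if_cong)
      then show ?thesis
        unfolding J_def expectation_state_split[OF dep, where h = ?v and i = i]
        by (simp add: sum_distrib_right mult.assoc)
    qed
    ultimately show "(\<lambda>q. e i j m (q + m)) \<longlonglongrightarrow> J i m * w j" by simp
  qed
  \<comment> \<open>The moment bound carries exactly the factor that normalises the probability, so
    the error is uniform in n; the geometric tail leaves r^m.\<close>
  have approx: "\<exists>K. \<forall>m n. 1 \<le> m \<longrightarrow> m \<le> n \<longrightarrow>
      \<bar>\<P>(\<omega> in M i. branching X \<xi> n \<omega> = z \<and> X n \<omega> = j) / ?k ^ n - e i j m n\<bar> \<le> K * r ^ m"
    if z: "1 \<le> z" for i j z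
  proof -
    obtain K where K: "K \<ge> 0" and near: "\<And>x m n. 1 \<le> m \<Longrightarrow> m \<le> n \<Longrightarrow>
        \<bar>lf_weight z (env_A \<rho> x n) (env_B \<rho> \<eta> x n) - 1 / (env_B \<rho> \<eta> x m)\<^sup>2\<bar>
          \<le> K * (\<Sum>l = m..n. env_A \<rho> x l powr \<delta>)"
      by (rule lf_weight_env_approx[OF \<delta> z]) blast
    have "\<bar>\<P>(\<omega> in M i. branching X \<xi> n \<omega> = z \<and> X n \<omega> = j) / ?k ^ n - e i j m n\<bar>
        \<le> (K * C / (1 - r)) * r ^ m" if mn: "1 \<le> m" "m \<le> n" for m n
    proof -
      define F where "F = (\<lambda>x. env_A \<rho> x n * lf_weight z (env_A \<rho> x n) (env_B \<rho> \<eta> x n) * indicat_real {j} (x n))"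
      define G where "G = (\<lambda>x. env_A \<rho> x n * (1 / (env_B \<rho> \<eta> x m)\<^sup>2) * indicat_real {j} (x n))"
      define H where "H = (\<lambda>l x. env_A \<rho> x n * env_A \<rho> x l powr \<delta>)"
      have F: "depends_upto n F"
        unfolding F_def by (rule depends_upto_env)
      have G: "depends_upto n G"
        unfolding G_def by (intro depends_upto_intros order_refl mn)
      have H: "depends_upto n (H l)" if "l \<in> {m..n}" for l
        unfolding H_def using that by (intro depends_upto_intros order_refl) auto
      have H_sum: "depends_upto n (\<lambda>x. K * (\<Sum>l = m..n. H l x))"
        by (intro depends_upto_intros H)
      have FG: "\<bar>F x - G x\<bar> \<le> K * (\<Sum>l = m..n. H l x)" for x
      proof -
        let ?d = "lf_weight z (env_A \<rho> x n) (env_B \<rho> \<eta> x n) - 1 / (env_B \<rho> \<eta> x m)\<^sup>2"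
        have "F x - G x = env_A \<rho> x n * ?d * indicat_real {j} (x n)"
          unfolding F_def G_def by (simp add: algebra_simps)
        then have "\<bar>F x - G x\<bar> \<le> env_A \<rho> x n * \<bar>?d\<bar>"
          using env_A_pos[of \<rho> x n] by (auto simp: abs_mult indicator_def)
        also have "\<dots> \<le> env_A \<rho> x n * (K * (\<Sum>l = m..n. env_A \<rho> x l powr \<delta>))"
          by (intro mult_left_mono near mn less_imp_le[OF env_A_pos])
        finally show ?thesis by (simp add: H_def sum_distrib_left mult_ac)
      qed
      have "\<bar>\<P>(\<omega> in M i. branching X \<xi> n \<omega> = z \<and> X n \<omega> = j) / ?k ^ n - e i j m n\<bar>
          = \<bar>(\<integral>\<omega>. F (\<lambda>k. X k \<omega>) \<partial>M i) - (\<integral>\<omega>. G (\<lambda>k. X k \<omega>) \<partial>M i)\<bar> / ?k ^ n"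
        using \<kappa>[of "-1"]
        by (simp add: branching_state_law[OF z] e_def F_def G_def abs_divide diff_divide_distrib[symmetric])
      also have "(\<integral>\<omega>. F (\<lambda>k. X k \<omega>) \<partial>M i) - (\<integral>\<omega>. G (\<lambda>k. X k \<omega>) \<partial>M i) = (\<integral>\<omega>. F (\<lambda>k. X k \<omega>) - G (\<lambda>k. X k \<omega>) \<partial>M i)"
        by (rule Bochner_Integration.integral_diff[symmetric]) (rule path_integrable F G)+
      also have "\<bar>\<integral>\<omega>. F (\<lambda>k. X k \<omega>) - G (\<lambda>k. X k \<omega>) \<partial>M i\<bar> \<le> (\<integral>\<omega>. \<bar>F (\<lambda>k. X k \<omega>) - G (\<lambda>k. X k \<omega>)\<bar> \<partial>M i)"
        by (rule integral_abs_bound)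
      also have "\<dots> \<le> (\<integral>\<omega>. K * (\<Sum>l = m..n. H l (\<lambda>k. X k \<omega>)) \<partial>M i)"
        by (intro integral_mono FG integrable_abs Bochner_Integration.integrable_diff
            path_integrable[OF F] path_integrable[OF G] path_integrable[OF H_sum])
      also have "\<dots> = K * (\<Sum>l = m..n. \<integral>\<omega>. H l (\<lambda>k. X k \<omega>) \<partial>M i)"
        by (simp add: Bochner_Integration.integral_sum path_integrable[OF H])
      also have "\<dots> \<le> K * (\<Sum>l = m..n. C * ?k ^ n * r ^ l)"
        unfolding H_def using K by (intro mult_left_mono sum_mono moment) auto
      also have "\<dots> = K * C * ?k ^ n * (\<Sum>l = m..n. r ^ l)"
        by (simp add: sum_distrib_left mult.assoc)
      also have "\<dots> \<le> K * C * ?k ^ n * (r ^ m / (1 - r))"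
        using K C \<kappa>[of "-1"] by (intro mult_left_mono geometric_tail_le r) auto
      finally show ?thesis using \<kappa>[of "-1"] by (simp add: divide_right_mono pos_divide_le_eq mult_ac)
    qed
    then show ?thesis by blast
  qed
  \<comment> \<open>The positive numbers \<open>J i m\<close> could still tend to 0 if the tilt sent
    B to infinity; truncation at a large level c excludes this.\<close>
  have J_lower: "\<exists>c>0. \<forall>m\<ge>1. c \<le> J i m" for i
  proof -
    define V where "V = Max (range ?v)"
    have V: "?v x \<le> V" for x unfolding V_def by (rule Max_ge) auto
    have V_pos: "V > 0" using v[of "-1" undefined] V[of undefined] by linarith
    \<comment> \<open>Solves V y C / (1 - r) = v(i) / 2, so that the truncation costs at most half
      of the main term v(i). The level c below is then the one with (\<open>\<eta>_max\<close> /
      c)^\<delta> = y.\<close>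
    define y where "y = ?v i * (1 - r) / (2 * V * C)"
    have y: "y > 0" using v[of "-1" i] r C V_pos by (simp add: y_def)
    define c where "c = \<eta>_max / y powr (1 / \<delta>)"
    have c: "c > 0" using \<eta>_bounds(4) y by (simp add: c_def)
    have cy: "(\<eta>_max / c) powr \<delta> = y"
      using \<eta>_bounds(4) y \<delta> by (simp add: c_def powr_powr)
    have "?v i / 2 / c\<^sup>2 \<le> J i m" if m: "1 \<le> m" for m
    proof -
      define F where "F = (\<lambda>x. env_A \<rho> x m * (1 / (env_B \<rho> \<eta> x m)\<^sup>2) * ?v (x m))"
      define G where "G = (\<lambda>x. env_A \<rho> x m * ?v (x m))"
      define H where "H = (\<lambda>l x. env_A \<rho> x m * env_A \<rho> x l powr \<delta>)"
      have F: "depends_upto m F" unfolding F_def by (rule depends_upto_env)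
      have G: "depends_upto m G" unfolding G_def by (intro depends_upto_intros order_refl)
      have H: "depends_upto m (H l)" if "l \<in> {0..<m}" for l
        unfolding H_def using that by (intro depends_upto_intros order_refl) auto
      have GH: "depends_upto m (\<lambda>x. (1 / c\<^sup>2) * (G x - V * y * (\<Sum>l = 0..<m. H l x)))"
        by (intro depends_upto_intros G H)
      have FGH: "(1 / c\<^sup>2) * (G x - V * y * (\<Sum>l = 0..<m. H l x)) \<le> F x" for x
      proof -
        let ?A = "env_A \<rho> x" and ?B = "env_B \<rho> \<eta> x"
        let ?min = "min 1 (?B m / c)"
        have Av: "0 \<le> ?A m * ?v (x m)" using env_A_pos[of \<rho> x m] v by (simp add: less_imp_le)
        have min0: "0 \<le> ?min" using env_B_nonneg[of x m] c by simp
        \<comment> \<open>The lower index is 0, where \<open>env_B\<close> vanishes, so the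
          increment estimate bounds B itself.\<close>
        have "?min \<le> y * (\<Sum>k = 0..<m. ?A k powr \<delta>)"
          using min_one_env_B_le[OF \<delta> c, of 0 m x] by (simp add: cy env_B_def)
        then have "(?A m * ?v (x m)) * ?min \<le> (?A m * V) * (y * (\<Sum>k = 0..<m. ?A k powr \<delta>))"
          using V v V_pos env_A_pos[of \<rho> x m] min0
          by (intro mult_mono) (auto simp: less_imp_le)
        then have "G x - V * y * (\<Sum>l = 0..<m. H l x) \<le> (?A m * ?v (x m)) * (1 - ?min)"
          by (simp add: G_def H_def sum_distrib_left right_diff_distrib mult_ac)
        then have "(1 / c\<^sup>2) * (G x - V * y * (\<Sum>l = 0..<m. H l x)) \<le> (1 / c\<^sup>2) * ((?A m * ?v (x m)) * (1 - ?min))"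
          by (rule mult_left_mono) simp
        also have "\<dots> = (?A m * ?v (x m)) * ((1 / c\<^sup>2) * (1 - ?min))" by simp
        also have "\<dots> \<le> (?A m * ?v (x m)) * (1 / (?B m)\<^sup>2)"
          using env_B_ge[OF m, of x] \<eta>_bounds(1)
          by (intro mult_left_mono inverse_square_lower_bound Av c) auto
        finally show ?thesis by (simp add: F_def mult_ac)
      qed
      have G_exp: "(\<integral>\<omega>. G (\<lambda>k. X k \<omega>) \<partial>M i) = ?k ^ m * ?v i"
      proof -
        have "(trans_op (Q (-1)) ^^ m) ?v = (\<lambda>x. ?k ^ m * ?v x)"
          by (rule trans_op_pow_eigenvector[OF eig])
        then show ?thesis
          using expectation_walk[where t = "-1" and n = m and g = ?v and i = i]
          by (simp add: G_def env_A_def)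
      qed
      have "?k ^ m * (?v i / 2 / c\<^sup>2) = (1 / c\<^sup>2) * (?k ^ m * ?v i - V * y * (C * ?k ^ m / (1 - r)))"
      proof -
        have "V * y * (C * ?k ^ m / (1 - r)) = (V * y * C) / (1 - r) * ?k ^ m" by simp
        also have "V * y * C = ?v i / 2 * (1 - r)" using C V_pos by (simp add: y_def)
        also have "?v i / 2 * (1 - r) / (1 - r) = ?v i / 2"
          using r(2) by (intro nonzero_mult_div_cancel_right) simp
        finally have "V * y * (C * ?k ^ m / (1 - r)) = ?v i / 2 * ?k ^ m" .
        then show ?thesis by (simp only:) (simp add: field_simps)
      qed
      also have "\<dots> \<le> (1 / c\<^sup>2) * ((\<integral>\<omega>. G (\<lambda>k. X k \<omega>) \<partial>M i) - V * y * (\<Sum>l = 0..<m. \<integral>\<omega>. H l (\<lambda>k. X k \<omega>) \<partial>M i))"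
      proof -
        have "(\<Sum>l = 0..<m. \<integral>\<omega>. H l (\<lambda>k. X k \<omega>) \<partial>M i) \<le> (\<Sum>l = 0..<m. C * ?k ^ m * r ^ l)"
          unfolding H_def by (intro sum_mono moment) auto
        also have "\<dots> \<le> (\<Sum>l = 0..m. C * ?k ^ m * r ^ l)"
          using C \<kappa>[of "-1"] r by (intro sum_mono2) auto
        also have "\<dots> = C * ?k ^ m * (\<Sum>l = 0..m. r ^ l)"
          by (simp add: sum_distrib_left)
        also have "\<dots> \<le> C * ?k ^ m * (r ^ 0 / (1 - r))"
          using C \<kappa>[of "-1"] by (intro mult_left_mono geometric_tail_le r) auto
        finally have "(\<Sum>l = 0..<m. \<integral>\<omega>. H l (\<lambda>k. X k \<omega>) \<partial>M i) \<le> C * ?k ^ m / (1 - r)" by simp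
        then have mid: "V * y * (\<Sum>l = 0..<m. \<integral>\<omega>. H l (\<lambda>k. X k \<omega>) \<partial>M i) \<le> V * y * (C * ?k ^ m / (1 - r))"
          using V_pos y by (intro mult_left_mono) auto
        show ?thesis unfolding G_exp by (rule mult_left_mono[OF diff_left_mono[OF mid]]) simp
      qed
      also have "\<dots> = (\<integral>\<omega>. (1 / c\<^sup>2) * (G (\<lambda>k. X k \<omega>) - V * y * (\<Sum>l = 0..<m. H l (\<lambda>k. X k \<omega>))) \<partial>M i)"
      proof -
        have "integrable (M i) (\<lambda>\<omega>. V * y * (\<Sum>l = 0..<m. H l (\<lambda>k. X k \<omega>)))"
          by (intro integrable_mult_right Bochner_Integration.integrable_sum path_integrable[OF H])
        then show ?thesis
          by (simp only: integral_mult_right_zero Bochner_Integration.integral_diff[OF path_integrable[OF G]]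
              Bochner_Integration.integral_sum[OF path_integrable[OF H]])
      qed
      also have "\<dots> \<le> (\<integral>\<omega>. F (\<lambda>k. X k \<omega>) \<partial>M i)"
        by (intro integral_mono FGH path_integrable[OF GH] path_integrable[OF F])
      also have "\<dots> = ?k ^ m * J i m" using \<kappa>[of "-1"] by (simp add: J_def F_def)
      finally have "?k ^ m * (?v i / 2 / c\<^sup>2) \<le> ?k ^ m * J i m" .
      then show ?thesis by (rule mult_left_le_imp_le) (use \<kappa>[of "-1"] in simp)
    qed
    moreover have "?v i / 2 / c\<^sup>2 > 0" using v[of "-1" i] c by simp
    ultimately show ?thesis by blast
  qed
  define u where "u = (\<lambda>i j. lim (\<lambda>m. J i m * w j))"
  have limits: "convergent (\<lambda>m. J i m * w j)"
    "(\<lambda>n. \<P>(\<omega> in M i. branching X \<xi> n \<omega> = z \<and> X n \<omega> = j) / ?k ^ n) \<longlonglongrightarrow> u i j" if z: "1 \<le> z" for i j z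
  proof -
    obtain K where K: "\<And>m n. 1 \<le> m \<Longrightarrow> m \<le> n \<Longrightarrow>
        \<bar>\<P>(\<omega> in M i. branching X \<xi> n \<omega> = z \<and> X n \<omega> = j) / ?k ^ n - e i j m n\<bar> \<le> K * r ^ m"
      using approx[OF z] by blast
    show "convergent (\<lambda>m. J i m * w j)"
      "(\<lambda>n. \<P>(\<omega> in M i. branching X \<xi> n \<omega> = z \<and> X n \<omega> = j) / ?k ^ n) \<longlonglongrightarrow> u i j"
      unfolding u_def by (rule approximate_limit[OF K e_lim r]; assumption)+
  qed
  have "u i j > 0" for i j
  proof -
    obtain c where c: "c > 0" "\<And>m. m \<ge> 1 \<Longrightarrow> c \<le> J i m" using J_lower by blast
    \<comment> \<open>This sequence does not involve z; the case z = 1 supplies its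
      convergence.\<close>
    have "(\<lambda>m. J i m * w j) \<longlonglongrightarrow> u i j"
      using limits(1)[OF order_refl] by (simp add: u_def convergent_LIMSEQ_iff)
    then have "c * w j \<le> u i j"
      by (rule LIMSEQ_le_const)
        (intro exI[of _ 1] allI impI mult_right_mono c(2) less_imp_le[OF w])
    moreover have "c * w j > 0" using c(1) w by simp
    ultimately show ?thesis by linarith
  qed
  with limits(2) show ?thesis by (intro exI[of _ u]) blast
qed

section \<open>Identification of k and conclusion\<close>

text \<open>\<open>walk_growth\<close> is a definite description, so a limit common to all start
  states has to be exhibited and shown unique. It follows that the Perron root does not depend on
  the chosen eigenvector.\<close>

lemma walk_growth_eq_perron_root:
  assumes prim: "primitive_env P" and \<kappa>: "\<kappa> > 0" and v: "\<And>x. v x > 0"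
    and eig: "\<And>x. trans_op (Q t) v x = \<kappa> * v x"
  shows "walk_growth \<rho> M X t = \<kappa>"
proof -
  have Q_nonneg: "0 \<le> Q t x y" for x y using P_nonneg by simp
  have Q_prim: "primitive_env (Q t)"
    by (rule primitive_env_scale_entries[OF P_nonneg prim]) simp
  have "(\<integral>\<omega>. exp (t * markov_walk \<rho> X n \<omega>) \<partial>M i) = (trans_op (Q t) ^^ n) (\<lambda>_. 1) i" for i n
    using expectation_walk[where t = t and n = n and g = "\<lambda>_. 1" and i = i]
    by (simp add: markov_walk_def)
  then have lim: "(\<lambda>n. (\<integral>\<omega>. exp (t * markov_walk \<rho> X n \<omega>) \<partial>M i) powr (1 / real n)) \<longlonglongrightarrow> \<kappa>" for i
    using perron_power_root[OF Q_nonneg Q_prim \<kappa> v eig] by simp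
  show ?thesis
    unfolding walk_growth_def
    by (rule the_equality) (use lim LIMSEQ_unique in blast)+
qed

end

theorem theorem1p1:
  fixes P :: "'x::finite \<Rightarrow> 'x \<Rightarrow> real"
    and a p :: "'x \<Rightarrow> real"
    and M :: "'x \<Rightarrow> 'w measure"
    and X :: "nat \<Rightarrow> 'w \<Rightarrow> 'x"
    and \<xi> :: "'x \<Rightarrow> nat \<Rightarrow> nat \<Rightarrow> 'w \<Rightarrow> nat"
  assumes "lf_branching_markov_env P a p M X \<xi>"
    and "primitive_env P"
    and "non_lattice_env P (log_mean a p)"
    and "supercritical a p"
    and "deriv (walk_growth (log_mean a p) M X) (-1) > 0"
  shows "\<exists>u :: 'x \<Rightarrow> 'x \<Rightarrow> real. (\<forall>i j. u i j > 0) \<and>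
           (\<forall>i j. \<forall>z\<ge>1.
              (\<lambda>n. \<P>(\<omega> in M i. branching X \<xi> n \<omega> = z \<and> X n \<omega> = j))
                \<sim>[sequentially] (\<lambda>n. walk_growth (log_mean a p) M X (-1) ^ n * u i j))"
proof -
  interpret lf_branching_markov_env P a p M X \<xi> by (rule assms(1))
  have perron: "\<exists>k v. k > 0 \<and> (\<forall>x. v x > 0) \<and> (\<forall>x. trans_op (Q t) v x = k * v x)" for t
  proof -
    have Q_nonneg: "0 \<le> Q t x y" for x y using P_nonneg by simp
    have Q_prim: "primitive_env (Q t)"
      by (rule primitive_env_scale_entries[OF P_nonneg assms(2)]) simp
    show ?thesis by (rule primitive_perron_eigenvector[OF Q_nonneg Q_prim]) blast
  qed
  obtain \<kappa> where "\<forall>t. \<exists>v. \<kappa> t > 0 \<and> (\<forall>x. v x > 0) \<and> (\<forall>x. trans_op (Q t) v x = \<kappa> t * v x)"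
    using choice[OF allI[OF perron]] by (rule exE)
  from choice[OF this] obtain v where
    "\<forall>t. \<kappa> t > 0 \<and> (\<forall>x. v t x > 0) \<and> (\<forall>x. trans_op (Q t) (v t) x = \<kappa> t * v t x)"
    by (rule exE)
  then have \<kappa>: "\<And>t. \<kappa> t > 0" and v: "\<And>t x. v t x > 0"
    and eig: "\<And>t x. trans_op (Q t) (v t) x = \<kappa> t * v t x"
    by blast+
  have growth: "walk_growth \<rho> M X = \<kappa>"
    using walk_growth_eq_perron_root[OF assms(2) \<kappa> v eig] by blast
  \<comment> \<open>Existence of the derivative comes first; only then does the hypothesis on
    \<open>deriv\<close> give the sign of D, and with it values of \<kappa> below \<kappa>(-1) to
    the left of -1.\<close>
  obtain D where D: "(\<kappa> has_real_derivative D) (at (-1))"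
    using perron_root_differentiable[OF P_nonneg assms(2) \<kappa> v eig] by blast
  have "D > 0" using assms(5) DERIV_imp_deriv[OF D] by (simp add: growth)
  then obtain d where d: "d > 0" "\<And>h. h > 0 \<Longrightarrow> h < d \<Longrightarrow> \<kappa> (-1 - h) < \<kappa> (-1)"
    using DERIV_pos_inc_left[OF D] by blast
  \<comment> \<open>Halving d gives \<delta> < d, and the bound by 1 is what
    \<open>min_one_le_powr\<close> asks for.\<close>
  define \<delta> where "\<delta> = min 1 (d / 2)"
  have \<delta>: "0 < \<delta>" "\<delta> \<le> 1" "\<delta> < d" using d(1) by (auto simp: \<delta>_def min_def)
  obtain u where u: "\<And>i j. u i j > 0"
    and lim: "\<And>i j z. z \<ge> 1 \<Longrightarrow>
      (\<lambda>n. \<P>(\<omega> in M i. branching X \<xi> n \<omega> = z \<and> X n \<omega> = j) / \<kappa> (-1) ^ n) \<longlonglongrightarrow> u i j"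
    using branching_state_limit[OF assms(2) \<kappa> v eig \<delta>(1,2) d(2)[OF \<delta>(1,3)]] by blast
  have "(\<lambda>n. \<P>(\<omega> in M i. branching X \<xi> n \<omega> = z \<and> X n \<omega> = j))
      \<sim>[sequentially] (\<lambda>n. \<kappa> (-1) ^ n * u i j)" if "z \<ge> 1" for i j z
  proof (rule asymp_equivI')
    have "(\<lambda>n. \<P>(\<omega> in M i. branching X \<xi> n \<omega> = z \<and> X n \<omega> = j) / \<kappa> (-1) ^ n / u i j) \<longlonglongrightarrow> u i j / u i j"
      using u[of i j] by (intro tendsto_divide lim that tendsto_const) simp
    then show "(\<lambda>n. \<P>(\<omega> in M i. branching X \<xi> n \<omega> = z \<and> X n \<omega> = j) / (\<kappa> (-1) ^ n * u i j)) \<longlonglongrightarrow> 1"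
      using u[of i j] by simp
  qed
  then show ?thesis unfolding growth using u by blast
qed

end
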